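(* Let $d\in\mathbb{N}$, let $(\mathbb{M},\mathbb{L},T)\in\mathcal{T}^d$, let $T$ be $d$-dimensional, and let $W(T,\mathbb{L})$ contain $d$ linearly independent vectors. Then the following statements hold: (a) There exist a basis $b_1^\ast,\ldots,b_d^\ast$ of the lattice $\mathbb{L}^\ast$ and $k\in\mathbb{N}$ with $k\le 2(3/2)^{d-2}(d!)^2$ and $W(T,\mathbb{L})\subseteq\sum_{i=1}^d\{-k,\ldots,k\}b_i^\ast$. (b) $|W(T,\mathbb{L})|<4^d$. (c) $\mathrm{vol}(\mathrm{conv}(W(T,\mathbb{L})))<\mathrm{vol}(D(T)^\circ)\le 4^d\det(\mathbb{L}^\ast)=4^d/\det(\mathbb{L})$.
   Context: $\mathbb{N}=\{1,2,3,\ldots\}$; $o$ is the origin of $\mathbb{R}^d$; $\langle\cdot,\cdot\rangle$ is the standard scalar product; $\mathrm{vol}$ is Lebesgue measure on $\mathbb{R}^d$; $X+Y=\{x+y: x\in X,\ y\in Y\}$ (Minkowski sum, also used in $\sum_{i=1}^d\{-k,\ldots,k\}b_i^\ast$, where $\{-k,\ldots,k\}b=\{mb: m\in\mathbb{Z},\ -k\le m\le k\}$). $D(X)=X-X=\{x-y:x,y\in X\}$. The polar of $K\subseteq\mathbb{R}^d$ is $K^\circ=\{x\in\mathbb{R}^d:\langle x,y\rangle\le 1\text{ for each }y\in K\}$. The dimension of $X\subseteq\mathbb{R}^d$ is the maximal number of affinely independent points in $X$ minus $1$. The sum $X+Y$ is called direct, and is then written $X\oplus Y$, if each $z\in X+Y$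 has a unique representation $z=x+y$ with $x\in X$, $y\in Y$. A lattice of rank $i$ in $\mathbb{R}^d$ is a set $\mathbb{Z}b_1+\cdots+\mathbb{Z}b_i$ with $b_1,\ldots,b_i$ linearly independent (a basis of the lattice). For a lattice $\mathbb{L}$ of rank $d$ with basis $b_1,\ldots,b_d$, $\det(\mathbb{L})=\mathrm{vol}((0,1]b_1+\cdots+(0,1]b_d)$. For a lattice $\mathbb{M}$ of rank $d$ in $\mathbb{R}^d$, a subset $K\subseteq\mathbb{M}$ is $\mathbb{M}$-convex if $K=C\cap\mathbb{M}$ for some convex $C\subseteq\mathbb{R}^d$. $\mathcal{T}^d$ is the set of all triples $(\mathbb{M},\mathbb{L},T)$ such that $\mathbb{M}$ and $\mathbb{L}$ are lattices of rank $d$ in $\mathbb{R}^d$ with $\mathbb{L}\subseteq\mathbb{M}$, $T$ is a nonempty finite $\mathbb{M}$-convex set, and $\mathbb{M}=\mathbb{L}\oplus T$. The dual lattice is $\mathbb{L}^\ast=\{y\in\mathbb{R}^d:\langle y,x\rangle\in\mathbb{Z}\text{ for each }x\in\mathbb{L}\}$. The width function is $w(K,u)=\sup_{x\in K}\langle u,x\rangle-\inf_{x\in K}\langle u,x\rangle$, and $W(K,\mathbb{L})=\{u\in\mathbb{L}^\ast\setminus\{o\}: w(K,u)<1\}$. *)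

theory Defs
  imports "HOL-Analysis.Analysis"
begin

text \<open>
  Sums of sets, both binary and indexed, are the Minkowski sums of \<^theory>\<open>HOL-Library.Set_Algebras\<close>.
  The library's difference of sets is the set-theoretic one, hence the separate
  \<open>difference_set\<close> below. The dimension \<open>d\<close> is \<open>CARD('n)\<close>.
\<close>

abbreviation vol :: "(real ^ 'n) set \<Rightarrow> real" where
  "vol \<equiv> measure lebesgue"

definition difference_set :: "(real ^ 'n) set \<Rightarrow> (real ^ 'n) set" where
  "difference_set X = {x - y | x y. x \<in> X \<and> y \<in> X}"

definition polar :: "(real ^ 'n) set \<Rightarrow> (real ^ 'n) set" where
  "polar K = {x. \<forall>y\<in>K. x \<bullet> y \<le> 1}"

definition direct_sum_rep :: "(real ^ 'n) set \<Rightarrow> (real ^ 'n) set \<Rightarrow> bool" where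
  "direct_sum_rep X Y \<longleftrightarrow> (\<forall>z\<in>X + Y. \<exists>!p. p \<in> X \<times> Y \<and> z = fst p + snd p)"

definition is_lattice_basis :: "nat \<Rightarrow> (nat \<Rightarrow> real ^ 'n) \<Rightarrow> (real ^ 'n) set \<Rightarrow> bool" where
  "is_lattice_basis r b L \<longleftrightarrow>
     inj_on b {1..r} \<and> independent (b ` {1..r}) \<and>
     L = (\<Sum>i\<in>{1..r}. range (\<lambda>m::int. of_int m *\<^sub>R b i))"

definition lattice_of_rank :: "nat \<Rightarrow> (real ^ 'n) set \<Rightarrow> bool" where
  "lattice_of_rank r L \<longleftrightarrow> (\<exists>b. is_lattice_basis r b L)"

text \<open>The volume below does not depend on the basis, so any basis may be chosen.\<close>

definition lattice_det :: "(real ^ 'n) set \<Rightarrow> real" where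
  "lattice_det L =
     (let b = (SOME b. is_lattice_basis CARD('n) b L)
      in vol (\<Sum>i\<in>{1..CARD('n)}. (\<lambda>t. t *\<^sub>R b i) ` {0<..1}))"

definition lattice_convex :: "(real ^ 'n) set \<Rightarrow> (real ^ 'n) set \<Rightarrow> bool" where
  "lattice_convex M K \<longleftrightarrow> K \<subseteq> M \<and> (\<exists>C. convex C \<and> K = C \<inter> M)"

definition tiling_triples :: "((real ^ 'n) set \<times> (real ^ 'n) set \<times> (real ^ 'n) set) set" where
  "tiling_triples = {(M, L, T).
     lattice_of_rank CARD('n) M \<and> lattice_of_rank CARD('n) L \<and> L \<subseteq> M \<and>
     T \<noteq> {} \<and> finite T \<and> lattice_convex M T \<and>
     M = L + T \<and> direct_sum_rep L T}"

definition dual_lattice :: "(real ^ 'n) set \<Rightarrow> (real ^ 'n) set" where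
  "dual_lattice L = {y. \<forall>x\<in>L. y \<bullet> x \<in> \<int>}"

text \<open>Real-valued supremum and infimum: meaningful for nonempty bounded \<open>K\<close>.\<close>

definition width :: "(real ^ 'n) set \<Rightarrow> real ^ 'n \<Rightarrow> real" where
  "width K u = (SUP x\<in>K. u \<bullet> x) - (INF x\<in>K. u \<bullet> x)"

definition width_vectors :: "(real ^ 'n) set \<Rightarrow> (real ^ 'n) set \<Rightarrow> (real ^ 'n) set" where
  "width_vectors K L = {u \<in> dual_lattice L - {0}. width K u < 1}"

end

theory Submission
  imports Defs "HOL-Analysis.Simplex_Content"
begin

text \<open>
  Write \<open>d = CARD('n)\<close>, let \<open>\<Lambda> = dual_lattice L\<close>, and let \<open>h u = width T u\<close>. Since \<open>T\<close> is finite and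
  full-dimensional, \<open>h\<close> is a norm, its unit ball is \<open>K = polar (difference_set T)\<close>, and the
  width vectors are the nonzero points of \<open>\<Lambda>\<close> in the interior of \<open>K\<close>. One fact about tilings carries
  everything (\<open>dual_vector_width_ge_half\<close>): every nonzero \<open>u\<close> in \<open>\<Lambda>\<close> has \<open>h u \<ge> 1/2\<close>. Indeed, let
  \<open>s\<close> and \<open>t\<close> be points of \<open>T\<close> at which \<open>u\<close> is largest and smallest. The point \<open>s + (s - t)\<close> of \<open>M\<close> is
  \<open>l + x\<close> with \<open>l\<close> in \<open>L\<close> and \<open>x\<close> in \<open>T\<close>; at this point \<open>u\<close> exceeds its minimum over \<open>T\<close> by exactly \<open>2 h u\<close>,
  and at \<open>x\<close> by at most \<open>h u\<close>. If \<open>0 < h u < 1/2\<close>, the integer \<open>u \<bullet> l\<close> would lie strictly between 0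
  and 1.

  Consequences for the number and the volume. Two vectors of norm less than 1 that are congruent
  modulo \<open>4\<Lambda>\<close> differ by \<open>4v\<close> with \<open>v\<close> in \<open>\<Lambda>\<close> and \<open>h v < 1/2\<close>, hence coincide; so the width vectors together with
  0 inject into \<open>\<Lambda>/4\<Lambda>\<close>, which has \<open>4^d\<close> elements (\<open>width_vectors_count\<close>). For the same reason
  the translates by \<open>\<Lambda>\<close> of a ball of radius less than 1/4 are disjoint, so its volume is at most
  \<open>det \<Lambda>\<close>, which gives \<open>vol K \<le> 4^d det \<Lambda>\<close> (\<open>polar_volume_bound\<close>). The width vectors are finitely many
  and have norm less than 1, so their convex hull lies in a strictly smaller dilate of \<open>K\<close>
  (\<open>width_vectors_hull_volume\<close>).

  For the basis (\<open>width_vectors_basis\<close>), choose \<open>d\<close> width vectors \<open>u\<^sub>1, \<dots>, u\<^sub>d\<close> of maximal absolute determinant.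
  By Cramer's rule every width vector is a combination of them with coefficients in \<open>[-1, 1]\<close>.
  There is a basis \<open>b\<^sub>1, \<dots>, b\<^sub>d\<close> of \<open>\<Lambda>\<close> adapted to them, as in the Hermite normal form: \<open>u\<^sub>i = \<Sum>\<^sub>k a\<^sub>i\<^sub>k b\<^sub>k\<close> with
  \<open>a\<^sub>i\<^sub>k = 0\<close> for \<open>k > i\<close> and \<open>0 \<le> a\<^sub>i\<^sub>k < a\<^sub>i\<^sub>i\<close> for \<open>k < i\<close>. The coordinates of a width vector in this
  basis are then bounded in absolute value by \<open>1 + \<Sum>\<^sub>i (a\<^sub>i\<^sub>i - 1)\<close>, which is at most \<open>k = \<Prod>\<^sub>i a\<^sub>i\<^sub>i\<close>, the index of the lattice spanned by the
  \<open>u\<^sub>i\<close> in \<open>\<Lambda>\<close>. That index is small because \<open>K\<close> contains the cross-polytope with vertices \<open>\<plusminus>u\<^sub>i\<close>,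
  of volume \<open>(2^d / d!) k det \<Lambda>\<close>; the volume bound gives \<open>k \<le> 2^d d!\<close>, which is
  at most \<open>2 (3/2)^(d-2) (d!)^2\<close> for \<open>d \<ge> 2\<close>. For \<open>d = 1\<close> one has \<open>u\<^sub>1 = k b\<^sub>1\<close>, so \<open>k/2 \<le> h u\<^sub>1 < 1\<close>
  and \<open>k = 1\<close>.
\<close>

section \<open>Linear images and Lebesgue measure\<close>

lemma swap_matrix_apply:
  "(*v) (\<chi> i j. mat 1 $ i $ Transposition.transpose m n j) = (\<lambda>x::real^'n. \<chi> i. x $ Transposition.transpose m n i)"
proof
  fix x :: "real^'n"
  have "(\<Sum>j\<in>UNIV. (if i = Transposition.transpose m n j then 1 else 0) * x $ j) = x $ Transposition.transpose m n i" for i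
  proof -
    have "(\<Sum>j\<in>UNIV. (if i = Transposition.transpose m n j then 1 else 0) * x $ j) =
       (\<Sum>j\<in>UNIV. (if j = Transposition.transpose m n i then x $ j else 0))"
      by (intro sum.cong) (auto simp: transpose_eq_iff)
    then show ?thesis by simp
  qed
  then show "(\<chi> i j. mat 1 $ i $ Transposition.transpose m n j) *v x = (\<chi> i. x $ Transposition.transpose m n i)"
    by (simp add: vec_eq_iff matrix_vector_mult_def mat_def)
qed

lemma shear_matrix_apply:
  assumes "m \<noteq> n"
  shows "(*v) (\<chi> i j. of_bool (i = m \<and> j = n \<or> i = j)) = (\<lambda>x::real^'n. \<chi> i. if i = m then x $ m + x $ n else x $ i)"
proof
  fix x :: "real^'n"
  have "(\<Sum>j\<in>UNIV. of_bool (i = m \<and> j = n \<or> i = j) * x $ j) = (if i = m then x $ m + x $ n else x $ i)" for i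
  proof -
    have "(\<Sum>j\<in>UNIV. of_bool (i = m \<and> j = n \<or> i = j) * x $ j) =
          (\<Sum>j\<in>UNIV. (if j = n then if i = m then x $ j else 0 else 0) + (if j = i then x $ j else 0))"
        using assms by (intro sum.cong) auto
    then show ?thesis by (simp add: sum.distrib)
  qed
  then show "(\<chi> i j. of_bool (i = m \<and> j = n \<or> i = j)) *v x = (\<chi> i. if i = m then x $ m + x $ n else x $ i)"
    by (simp add: vec_eq_iff matrix_vector_mult_def)
qed

lemma measure_swap_box:
  fixes a b :: "real^'n"
  shows "measure lebesgue ((\<lambda>x. \<chi> i. x $ Transposition.transpose m n i) ` cbox a b) = measure lebesgue (cbox a b)" (is "_ (?f ` _) = _")
proof -
  have im: "?f ` cbox a b = cbox (?f a) (?f b)"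
    by (auto simp: image_iff lambda_swap_Galois mem_box_cart) (metis transpose_involutory)+
  have e: "cbox (?f a) (?f b) = {} \<longleftrightarrow> cbox a b = {}"
    by (metis im image_is_empty)
  have "(\<Prod>i\<in>UNIV. (b - a) $ Transposition.transpose m n i) = (\<Prod>i\<in>UNIV. (b - a) $ i)"
    using prod.permute [of "Transposition.transpose m n" UNIV "\<lambda>i. (b - a) $ i"]
    by (simp add: permutes_swap_id o_def)
  then show ?thesis
    unfolding im using e by (cases "cbox a b = {}") (simp_all add: content_cbox_cart)
qed

lemma measure_shear_box:
  fixes a b :: "real^'n"
  assumes "m \<noteq> n"
  shows "measure lebesgue ((\<lambda>x. \<chi> i. if i = m then x $ m + x $ n else x $ i) ` cbox a b) = measure lebesgue (cbox a b)" (is "_ (?f ` _) = _")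
proof (cases "cbox a b = {}")
  case False
  have lin: "linear ?f"
    by (rule linearI) (auto simp: vec_eq_iff algebra_simps)
  \<comment> \<open>Translate first: the formula for shears is available for boxes with nonnegative \<open>n\<close>-th coordinates.\<close>
  define v where "v = axis n (- a $ n)"
  have "cbox a b = (+) (- v) ` cbox (v + a) (v + b)"
    by (simp only: cbox_translation [symmetric]) simp
  then have "?f ` cbox a b = (+) (?f (- v)) ` ?f ` cbox (v + a) (v + b)"
    by (simp only: image_image linear_add [OF lin])
  then have "measure lebesgue (?f ` cbox a b) = measure lebesgue (?f ` cbox (v + a) (v + b))"
    by (simp only: measure_translation)
  also have "\<dots> = measure lebesgue (cbox (v + a) (v + b))"
  proof (rule measure_shear_interval [OF assms])
    show "cbox (v + a) (v + b) \<noteq> {}" using False by (simp add: cbox_translation)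
    show "0 \<le> (v + a) $ n" by (simp add: v_def)
  qed
  also have "\<dots> = measure lebesgue (cbox a b)"
    unfolding cbox_translation by (rule measure_translation)
  finally show ?thesis .
qed simp

text \<open>
  Both sides are multiplicative in \<open>A\<close>, so it is enough to treat elementary matrices. A singular or
  diagonal one is handled directly; a swap and a shear have determinant of absolute value 1, and it is enough
  to see that they preserve the volume of boxes.
\<close>

lemma measure_matrix_image:
  fixes A :: "real^'n^'n"
  assumes "S \<in> lmeasurable"
  shows "(*v) A ` S \<in> lmeasurable \<and> measure lebesgue ((*v) A ` S) = \<bar>det A\<bar> * measure lebesgue S"
proof -
  define P where "P A \<longleftrightarrow> (\<forall>S\<in>lmeasurable. (*v) A ` S \<in> lmeasurable \<and>
      measure lebesgue ((*v) A ` S) = \<bar>det A\<bar> * measure lebesgue S)" for A :: "real^'n^'n"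
  have "P A"
  proof (rule induct_matrix_elementary_alt [where P = P])
    fix A B :: "real^'n^'n"
    assume "P A" "P B"
    moreover have "(*v) (A ** B) ` S = (*v) A ` (*v) B ` S" for S
      by (simp add: image_image matrix_vector_mul_assoc)
    ultimately show "P (A ** B)"
      by (simp add: P_def det_mul abs_mult)
  next
    fix A :: "real^'n^'n" and i
    assume r: "row i A = 0"
    have sub: "(*v) A ` S \<subseteq> {x. x $ i = 0}" for S
      using r by (auto simp: matrix_vector_mult_def row_def vec_eq_iff)
    have "negligible ((*v) A ` S)" for S
      by (rule negligible_subset [OF negligible_standard_hyperplane_cart sub])
    moreover have "det A = 0"
      using r by (rule det_zero_row)
    ultimately show "P A"
      by (simp add: P_def negligible_iff_measure)
  next
    fix A :: "real^'n^'n"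
    assume d: "\<And>i j. i \<noteq> j \<Longrightarrow> A $ i $ j = 0"
    have "(\<Sum>j\<in>UNIV. A $ i $ j * x $ j) = A $ i $ i * x $ i" for x :: "real^'n" and i
      by (subst sum.remove [of _ i]) (auto intro!: sum.neutral simp: d)
    then have eq: "(*v) A = (\<lambda>x. \<chi> k. A $ k $ k * x $ k)"
      by (simp add: fun_eq_iff vec_eq_iff matrix_vector_mult_def)
    have "det A = (\<Prod>k\<in>UNIV. A $ k $ k)"
      using d by (rule det_diagonal)
    then show "P A"
      unfolding P_def eq
      using measurable_stretch [of _ "\<lambda>k. A $ k $ k"] measure_stretch [of _ "\<lambda>k. A $ k $ k"]
      by simp
  next
    fix m n :: 'n
    let ?T = "(\<chi> i j. mat 1 $ i $ Transposition.transpose m n j) :: real^'n^'n"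
    have det1: "\<bar>det ?T\<bar> = 1"
      by (simp add: det_permute_columns permutes_swap_id abs_mult sign_def)
    have box: "measure lebesgue ((*v) ?T ` cbox a b) = 1 * measure lebesgue (cbox a b)" for a b
      using measure_swap_box [of m n a b] by (simp only: swap_matrix_apply mult_1)
    show "P ?T"
      unfolding P_def
    proof
      fix S :: "(real^'n) set"
      assume "S \<in> lmeasurable"
      from measure_linear_sufficient [OF matrix_vector_mul_linear this box]
      show "(*v) ?T ` S \<in> lmeasurable \<and> measure lebesgue ((*v) ?T ` S) = \<bar>det ?T\<bar> * measure lebesgue S"
        by (simp only: det1)
    qed
  next
    fix m n :: 'n
    assume mn: "m \<noteq> n"
    let ?E = "(\<chi> i j. of_bool (i = m \<and> j = n \<or> i = j)) :: real^'n^'n"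
    have "?E = (\<chi> k. if k = m then row m (mat 1) + 1 *s row n (mat 1) else row k (mat 1))"
      using mn by (auto simp: vec_eq_iff row_def mat_def)
    then have "det ?E = 1"
      by (simp only: det_row_operation [OF mn] det_I)
    then have det1: "\<bar>det ?E\<bar> = 1"
      by linarith
    have box: "measure lebesgue ((*v) ?E ` cbox a b) = 1 * measure lebesgue (cbox a b)" for a b
      using measure_shear_box [OF mn, of a b] by (simp only: shear_matrix_apply [OF mn] mult_1)
    show "P ?E"
      unfolding P_def
    proof
      fix S :: "(real^'n) set"
      assume "S \<in> lmeasurable"
      from measure_linear_sufficient [OF matrix_vector_mul_linear this box]
      show "(*v) ?E ` S \<in> lmeasurable \<and> measure lebesgue ((*v) ?E ` S) = \<bar>det ?E\<bar> * measure lebesgue S"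
        by (simp only: det1)
    qed
  qed
  then show ?thesis using assms by (simp add: P_def)
qed

section \<open>Lattices as matrix images of the integer vectors\<close>

definition int_vectors :: "(real^'n) set" where
  "int_vectors = {z. \<forall>i. z $ i \<in> \<int>}"

text \<open>
  Lattice bases are indexed by \<open>{1..CARD('n)}\<close> and matrix columns by \<open>'n\<close>. One fixed enumeration of
  \<open>'n\<close> translates between the two, so that a basis becomes an invertible matrix.
\<close>

definition enum_index :: "'n::finite \<Rightarrow> nat" where
  "enum_index = (SOME e. bij_betw e UNIV {1..CARD('n)})"

definition basis_matrix :: "(nat \<Rightarrow> real^'n) \<Rightarrow> real^'n^'n" where
  "basis_matrix b = (\<chi> i j. b (enum_index j) $ i)"

lemma bij_enum_index: "bij_betw (enum_index :: 'n::finite \<Rightarrow> nat) UNIV {1..CARD('n)}"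
proof -
  have "\<exists>e :: 'n \<Rightarrow> nat. bij_betw e UNIV {1..CARD('n)}"
    by (rule finite_same_card_bij) auto
  then show ?thesis
    unfolding enum_index_def by (rule someI_ex)
qed

lemma inj_enum_index: "inj enum_index"
  using bij_enum_index by (rule bij_betw_imp_inj_on)

lemma enum_index_in: "enum_index (j::'n::finite) \<in> {1..CARD('n)}"
  using bij_enum_index bij_betwE by blast

lemma obtain_enum_index:
  assumes "i \<in> {1..CARD('n)}"
  obtains j :: "'n::finite" where "enum_index j = i"
  using assms bij_enum_index by (metis bij_betw_iff_bijections)

lemma sum_enum_index: "(\<Sum>j\<in>UNIV. f (enum_index (j::'n::finite))) = (\<Sum>i\<in>{1..CARD('n)}. f i)"
  by (rule sum.reindex_bij_betw [OF bij_enum_index])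

lemma prod_enum_index: "(\<Prod>j\<in>UNIV. f (enum_index (j::'n::finite))) = (\<Prod>i\<in>{1..CARD('n)}. f i)"
  by (rule prod.reindex_bij_betw [OF bij_enum_index])

lemma basis_matrix_mult:
  fixes b :: "nat \<Rightarrow> real^'n"
  shows "basis_matrix b *v (\<chi> j. c (enum_index j)) = (\<Sum>i\<in>{1..CARD('n)}. c i *\<^sub>R b i)"
proof -
  have "basis_matrix b *v (\<chi> j. c (enum_index j)) = (\<Sum>j\<in>UNIV. c (enum_index j) *\<^sub>R b (enum_index (j::'n)))"
    by (simp add: basis_matrix_def vec_eq_iff matrix_vector_mult_def mult.commute)
  also have "\<dots> = (\<Sum>i\<in>{1..CARD('n)}. c i *\<^sub>R b i)"
    by (rule sum_enum_index [of "\<lambda>i. c i *\<^sub>R b i"])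
  finally show ?thesis .
qed

lemma vec_as_enum:
  fixes x :: "real^'n"
  obtains c where "x = (\<chi> j. c (enum_index j))"
proof
  show "x = (\<chi> j. x $ (inv enum_index (enum_index j)))"
    by (simp add: inj_enum_index)
qed

lemma basis_matrix_surj:
  fixes B :: "real^'n^'n"
  obtains b where "basis_matrix b = B"
proof
  show "basis_matrix (\<lambda>i. column (inv enum_index i) B) = B"
    by (simp add: basis_matrix_def column_def inj_enum_index)
qed

lemma independent_family_iff:
  fixes b :: "'i \<Rightarrow> 'a::real_vector"
  assumes "finite I"
  shows "inj_on b I \<and> independent (b ` I) \<longleftrightarrow>
         (\<forall>c. (\<Sum>i\<in>I. c i *\<^sub>R b i) = 0 \<longrightarrow> (\<forall>i\<in>I. c i = 0))"
proof (intro iffI conjI allI impI)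
  fix c :: "'i \<Rightarrow> real"
  assume b: "inj_on b I \<and> independent (b ` I)" and c: "(\<Sum>i\<in>I. c i *\<^sub>R b i) = 0"
  have "(\<Sum>v\<in>b ` I. c (inv_into I b v) *\<^sub>R v) = (\<Sum>i\<in>I. c i *\<^sub>R b i)"
    using b by (simp add: sum.reindex)
  then have sum0: "(\<Sum>v\<in>b ` I. c (inv_into I b v) *\<^sub>R v) = 0"
    using c by simp
  have "\<forall>v\<in>b ` I. c (inv_into I b v) = 0"
  proof (rule ccontr)
    assume "\<not> (\<forall>v\<in>b ` I. c (inv_into I b v) = 0)"
    then have "dependent (b ` I)"
      unfolding dependent_finite [OF finite_imageI [OF assms]]
      using sum0 by (intro exI [of _ "\<lambda>v. c (inv_into I b v)"] conjI) blast+
    then show False using b by blast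
  qed
  then show "\<forall>i\<in>I. c i = 0"
    using b by auto
next
  assume *: "\<forall>c. (\<Sum>i\<in>I. c i *\<^sub>R b i) = 0 \<longrightarrow> (\<forall>i\<in>I. c i = 0)"
  show "inj_on b I"
  proof (rule inj_onI, rule ccontr)
    fix i j assume ij: "i \<in> I" "j \<in> I" "b i = b j" "i \<noteq> j"
    let ?c = "\<lambda>k. (if k = i then 1 else 0) - (if k = j then 1 else (0::real))"
    have "(\<Sum>k\<in>I. ?c k *\<^sub>R b k) = 
      (\<Sum>k\<in>I. (if k = i then b k else 0)) - (\<Sum>k\<in>I. (if k = j then b k else 0))"
      unfolding sum_subtractf [symmetric] by (rule sum.cong) (auto simp: algebra_simps)
    also have "\<dots> = 0"
      using ij assms by simp
    finally have "(\<Sum>k\<in>I. ?c k *\<^sub>R b k) = 0" .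
    then have "\<forall>k\<in>I. ?c k = 0"
      using spec [OF *, of ?c] by (rule rev_mp)
    then have "?c i = 0" using ij(1) by (rule bspec)
    then show False using ij by simp
  qed
  then have "(\<Sum>v\<in>b ` I. u v *\<^sub>R v) = (\<Sum>i\<in>I. u (b i) *\<^sub>R b i)" for u
    by (simp add: sum.reindex)
  then show "independent (b ` I)"
    using * assms by (auto simp: dependent_finite)
qed

lemma independent_basis_matrix_iff:
  fixes b :: "nat \<Rightarrow> real^'n"
  shows "inj_on b {1..CARD('n)} \<and> independent (b ` {1..CARD('n)}) \<longleftrightarrow> det (basis_matrix b) \<noteq> 0"
proof -
  have "det (basis_matrix b) \<noteq> 0 \<longleftrightarrow> (\<forall>x. basis_matrix b *v x = 0 \<longrightarrow> x = 0)"
    by (simp add: invertible_det_nz [symmetric] invertible_left_inverse matrix_left_invertible_ker)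
  also have "\<dots> \<longleftrightarrow> (\<forall>c. (\<Sum>i\<in>{1..CARD('n)}. c i *\<^sub>R b i) = 0 \<longrightarrow> (\<forall>i\<in>{1..CARD('n)}. c i = 0))"
  proof (intro iffI allI impI ballI)
    fix c i assume *: "\<forall>x. basis_matrix b *v x = 0 \<longrightarrow> x = 0"
      and c: "(\<Sum>i\<in>{1..CARD('n)}. c i *\<^sub>R b i) = 0" and i: "i \<in> {1..CARD('n)}"
    have "(\<chi> j::'n. c (enum_index j)) = 0"
      using * c basis_matrix_mult [of b c] by metis
    moreover obtain j :: 'n where "enum_index j = i"
      using i by (rule obtain_enum_index)
    ultimately show "c i = 0"
      by (auto simp: vec_eq_iff)
  next
    fix x :: "real^'n" assume *: "\<forall>c. (\<Sum>i\<in>{1..CARD('n)}. c i *\<^sub>R b i) = 0 \<longrightarrow> (\<forall>i\<in>{1..CARD('n)}. c i = 0)"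
      and x: "basis_matrix b *v x = 0"
    obtain c where c: "x = (\<chi> j. c (enum_index j))"
      by (rule vec_as_enum)
    have "\<forall>i\<in>{1..CARD('n)}. c i = 0"
      using * x unfolding c basis_matrix_mult by blast
    then have "c (enum_index (j::'n)) = 0" for j
      using enum_index_in by blast
    then show "x = 0"
      unfolding c by (simp add: vec_eq_iff)
  qed
  finally show ?thesis
    by (simp add: independent_family_iff)
qed

text \<open>
  The common form of the three Minkowski sums that occur: a lattice (all integers), its
  fundamental parallelepiped (the interval \<open>{0<..1}\<close>) and the set of lattice points whose coordinates are bounded
  by \<open>k\<close>.
\<close>

lemma set_sum_image_eq:
  fixes b :: "nat \<Rightarrow> real^'n"
  shows "(\<Sum>i\<in>{1..CARD('n)}. (\<lambda>t. f t *\<^sub>R b i) ` X) = (*v) (basis_matrix b) ` {x. \<forall>i. x $ i \<in> f ` X}"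
proof -
  have "(\<Sum>i\<in>{1..CARD('n)}. (\<lambda>t. f t *\<^sub>R b i) ` X) =
      {\<Sum>i\<in>{1..CARD('n)}. c i *\<^sub>R b i | c. \<forall>i\<in>{1..CARD('n)}. c i \<in> f ` X}" (is "?l = ?r")
  proof
    show "?l \<subseteq> ?r"
    proof
      fix x assume "x \<in> ?l"
      then obtain s where x: "x = sum s {1..CARD('n)}"
        and s: "\<forall>i\<in>{1..CARD('n)}. s i \<in> (\<lambda>t. f t *\<^sub>R b i) ` X"
        by (auto simp: set_sum_alt)
      have "\<forall>i\<in>{1..CARD('n)}. \<exists>t. t \<in> X \<and> s i = f t *\<^sub>R b i"
        using s by blast
      from bchoice [OF this] obtain t
        where t: "\<forall>i\<in>{1..CARD('n)}. t i \<in> X \<and> s i = f (t i) *\<^sub>R b i" ..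
      have "x = (\<Sum>i\<in>{1..CARD('n)}. f (t i) *\<^sub>R b i)"
        unfolding x using t by (intro sum.cong) auto
      then show "x \<in> ?r"
        using t by (auto intro!: exI [of _ "\<lambda>i. f (t i)"])
    qed
    show "?r \<subseteq> ?l"
    proof
      fix x assume "x \<in> ?r"
      then obtain c where c: "x = (\<Sum>i\<in>{1..CARD('n)}. c i *\<^sub>R b i)" "\<forall>i\<in>{1..CARD('n)}. c i \<in> f ` X"
        by blast
      have "\<forall>i\<in>{1..CARD('n)}. c i *\<^sub>R b i \<in> (\<lambda>t. f t *\<^sub>R b i) ` X"
      proof
        fix i assume "i \<in> {1..CARD('n)}"
        with c(2) obtain t where "c i = f t" "t \<in> X" by blast
        then show "c i *\<^sub>R b i \<in> (\<lambda>t. f t *\<^sub>R b i) ` X"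
          by (intro image_eqI [of _ _ t]) simp_all
      qed
      then show "x \<in> ?l"
        unfolding set_sum_alt [OF finite_atLeastAtMost] c(1) by blast
    qed
  qed
  also have "\<dots> = (*v) (basis_matrix b) ` {x. \<forall>i. x $ i \<in> f ` X}"
  proof (intro set_eqI iffI)
    fix y assume "y \<in> {\<Sum>i\<in>{1..CARD('n)}. c i *\<^sub>R b i | c. \<forall>i\<in>{1..CARD('n)}. c i \<in> f ` X}"
    then obtain c where "y = basis_matrix b *v (\<chi> j. c (enum_index j))" "\<forall>i\<in>{1..CARD('n)}. c i \<in> f ` X"
      unfolding basis_matrix_mult by blast
    then show "y \<in> (*v) (basis_matrix b) ` {x. \<forall>i. x $ i \<in> f ` X}"
      using enum_index_in [where 'n='n] by (intro image_eqI [of _ _ "\<chi> j. c (enum_index j)"]) simp_all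
  next
    fix y assume "y \<in> (*v) (basis_matrix b) ` {x. \<forall>i. x $ i \<in> f ` X}"
    then obtain x where x: "y = basis_matrix b *v x" "\<forall>i. x $ i \<in> f ` X"
      by blast
    obtain c where c: "x = (\<chi> j. c (enum_index j))"
      by (rule vec_as_enum)
    have "c i \<in> f ` X" if "i \<in> {1..CARD('n)}" for i
      using that x(2) unfolding c by (metis obtain_enum_index vec_lambda_beta)
    then show "y \<in> {\<Sum>i\<in>{1..CARD('n)}. c i *\<^sub>R b i | c. \<forall>i\<in>{1..CARD('n)}. c i \<in> f ` X}"
      using x(1) unfolding c basis_matrix_mult by blast
  qed
  finally show ?thesis .
qed

lemma is_lattice_basis_iff:
  fixes b :: "nat \<Rightarrow> real^'n"
  shows "is_lattice_basis CARD('n) b L \<longleftrightarrow>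
    det (basis_matrix b) \<noteq> 0 \<and> L = (*v) (basis_matrix b) ` int_vectors"
proof -
  have "(\<Sum>i\<in>{1..CARD('n)}. range (\<lambda>m::int. of_int m *\<^sub>R b i)) = (*v) (basis_matrix b) ` int_vectors"
    unfolding set_sum_image_eq int_vectors_def Ints_def ..
  then show ?thesis
    using independent_basis_matrix_iff [of b] by (auto simp: is_lattice_basis_def)
qed

section \<open>The determinant of a lattice and of its dual\<close>

lemma integer_matrix_det:
  fixes U :: "real^'n^'n"
  assumes "\<And>i j. U $ i $ j \<in> \<int>"
  shows "det U \<in> \<int>"
  unfolding det_def using assms by (intro Ints_sum Ints_mult Ints_prod) auto

lemma integer_factor:
  fixes A B :: "real^'n^'n"
  assumes "\<And>j. column j A \<in> (*v) B ` int_vectors"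
  obtains U where "\<And>i j. U $ i $ j \<in> \<int>" "A = B ** U"
proof -
  have "\<forall>j. \<exists>u. u \<in> int_vectors \<and> column j A = B *v u"
    using assms by blast
  then obtain u where u: "\<And>j. u j \<in> int_vectors" "\<And>j. column j A = B *v u j"
    by metis
  define U :: "real^'n^'n" where "U = (\<chi> i j. u j $ i)"
  have "column j (B ** U) = column j A" for j
    unfolding u(2) by (simp add: U_def vec_eq_iff column_def matrix_matrix_mult_def matrix_vector_mult_def)
  then have "A = B ** U"
    by (simp add: column_def vec_eq_iff)
  moreover have "U $ i $ j \<in> \<int>" for i j
    using u(1) [of j] by (simp add: U_def int_vectors_def)
  ultimately show thesis
    using that by blast
qed

text \<open>
  If one lattice contains another, a matrix of the smaller one is a matrix of the larger one times an integer matrix,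
  whose determinant is a nonzero integer. Applied in both directions, this shows that
  all bases of a lattice have the same absolute determinant.
\<close>

lemma lattice_subset_det:
  fixes A B :: "real^'n^'n"
  assumes sub: "(*v) A ` int_vectors \<subseteq> (*v) B ` int_vectors" and nz: "det A \<noteq> 0"
  shows "\<bar>det B\<bar> \<le> \<bar>det A\<bar>"
proof -
  have "column j A \<in> (*v) B ` int_vectors" for j
  proof -
    have "axis j 1 \<in> (int_vectors :: (real^'n) set)"
      by (auto simp: int_vectors_def axis_def)
    then show ?thesis
      using sub by (metis imageI matrix_vector_mult_basis subsetD)
  qed
  then obtain U :: "real^'n^'n" where U: "\<And>i j. U $ i $ j \<in> \<int>" "A = B ** U"
    using integer_factor [of A B] by blast
  have det: "det A = det B * det U"
    by (simp add: U(2) det_mul)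
  have "det U \<noteq> 0"
    using det nz by auto
  then have "1 \<le> \<bar>det U\<bar>"
    using integer_matrix_det [OF U(1)] by (intro Ints_nonzero_abs_ge1)
  then show ?thesis
    unfolding det abs_mult by (simp add: mult_le_cancel_left1)
qed

lemma lattice_eq_det:
  fixes A B :: "real^'n^'n"
  assumes "(*v) A ` int_vectors = (*v) B ` int_vectors" "det A \<noteq> 0" "det B \<noteq> 0"
  shows "\<bar>det A\<bar> = \<bar>det B\<bar>"
  using assms lattice_subset_det [of A B] lattice_subset_det [of B A] by (simp add: order_antisym)

lemma measure_half_open_cube:
  "{x::real^'n. \<forall>i. x $ i \<in> {0<..1}} \<in> lmeasurable"
  "measure lebesgue {x::real^'n. \<forall>i. x $ i \<in> {0<..1}} = 1"
proof -
  let ?C = "{x::real^'n. \<forall>i. x $ i \<in> {0<..1}}"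
  have sub: "box 0 1 \<subseteq> ?C" "?C \<subseteq> cbox 0 1"
    by (auto simp: mem_box_cart less_imp_le)
  have "convex {x::real^'n. x $ i \<in> {0<..1}}" for i
    using convex_linear_vimage [of "\<lambda>x::real^'n. x $ i" "{0<..1}"]
    by (simp add: bounded_linear.linear [OF bounded_linear_vec_nth] vimage_def)
  then have "convex ?C"
    unfolding Collect_all_eq by (intro convex_INT) auto
  moreover have "bounded ?C"
    using sub(2) bounded_cbox bounded_subset by blast
  ultimately show C: "?C \<in> lmeasurable"
    by (intro measurable_convex)
  have "measure lebesgue (box 0 (1::real^'n)) \<le> measure lebesgue ?C"
    using sub C by (intro measure_mono_fmeasurable) auto
  moreover have "measure lebesgue ?C \<le> measure lebesgue (cbox 0 (1::real^'n))"
    using sub C by (intro measure_mono_fmeasurable) auto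
  moreover have "measure lebesgue (cbox 0 (1::real^'n)) = 1"
    by (simp add: content_cbox_if_cart interval_eq_empty_cart)
  moreover have "measure lebesgue (box 0 (1::real^'n)) = measure lebesgue (cbox 0 (1::real^'n))"
    by (simp add: measure_lborel_box_eq measure_lborel_cbox_eq)
  ultimately show "measure lebesgue ?C = 1"
    by simp
qed

text \<open>
  The definition of the determinant chooses a basis; this frees it from the choice.
\<close>

lemma lattice_det_basis:
  fixes b :: "nat \<Rightarrow> real^'n"
  assumes "is_lattice_basis CARD('n) b L"
  shows "lattice_det L = \<bar>det (basis_matrix b)\<bar>"
proof -
  define c where "c = (SOME b. is_lattice_basis CARD('n) b L)"
  have c: "is_lattice_basis CARD('n) c L"
    unfolding c_def using assms by (rule someI [of "\<lambda>b. is_lattice_basis CARD('n) b L"])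
  have "lattice_det L = vol (\<Sum>i\<in>{1..CARD('n)}. (\<lambda>t. t *\<^sub>R c i) ` {0<..1})"
    by (simp add: lattice_det_def c_def Let_def)
  also have "\<dots> = vol ((*v) (basis_matrix c) ` {x. \<forall>i. x $ i \<in> {0<..1}})"
    using set_sum_image_eq [of "\<lambda>t. t" c "{0<..1}"] by simp
  also have "\<dots> = \<bar>det (basis_matrix c)\<bar>"
    using measure_matrix_image [OF measure_half_open_cube(1), of "basis_matrix c"]
    unfolding measure_half_open_cube(2) by simp
  also have "\<dots> = \<bar>det (basis_matrix b)\<bar>"
    using assms c by (intro lattice_eq_det) (auto simp: is_lattice_basis_iff)
  finally show ?thesis .
qed

lemma int_vectors_inner_iff:
  "(\<forall>z\<in>int_vectors. w \<bullet> z \<in> \<int>) \<longleftrightarrow> w \<in> int_vectors"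
proof
  assume *: "\<forall>z\<in>int_vectors. w \<bullet> z \<in> \<int>"
  have "w $ i \<in> \<int>" for i
  proof -
    have "axis i 1 \<in> (int_vectors :: (real^'a) set)"
      by (auto simp: int_vectors_def axis_def)
    then show ?thesis
      using * by (metis cart_eq_inner_axis)
  qed
  then show "w \<in> int_vectors" by (simp add: int_vectors_def)
next
  assume "w \<in> int_vectors"
  then show "\<forall>z\<in>int_vectors. w \<bullet> z \<in> \<int>"
    by (auto simp: int_vectors_def inner_vec_def intro!: Ints_sum Ints_mult)
qed

text \<open>
  The inner product of \<open>y\<close> with \<open>A z\<close> is that of \<open>A\<^sup>T y\<close> with \<open>z\<close>, and a vector has integral inner products with all integer
  vectors just when it is one. So the transposed inverse of \<open>A\<close> is a basis matrix of the dual lattice.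
\<close>

lemma dual_lattice_matrix:
  fixes A :: "real^'n^'n"
  assumes "det A \<noteq> 0"
  shows "dual_lattice ((*v) A ` int_vectors) = (*v) (transpose (matrix_inv A)) ` int_vectors"
    and "det (transpose (matrix_inv A)) = 1 / det A"
proof -
  have inv: "A ** matrix_inv A = mat 1" "matrix_inv A ** A = mat 1"
    using assms someI_ex [of "\<lambda>A'. A ** A' = mat 1 \<and> A' ** A = mat 1"]
    by (auto simp: invertible_det_nz [symmetric] invertible_def matrix_inv_def)
  have "det A * det (matrix_inv A) = 1"
    using inv(1) by (metis det_I det_mul)
  then show "det (transpose (matrix_inv A)) = 1 / det A"
    using assms by (simp add: det_transpose field_simps)
  have tinv: "transpose A ** transpose (matrix_inv A) = mat 1" "transpose (matrix_inv A) ** transpose A = mat 1"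
    using inv by (simp_all add: matrix_transpose_mul [symmetric] transpose_mat)
  have "y \<in> dual_lattice ((*v) A ` int_vectors) \<longleftrightarrow> transpose A *v y \<in> int_vectors" for y
    unfolding int_vectors_inner_iff [symmetric]
    by (simp add: dual_lattice_def transpose_matrix_vector dot_lmul_matrix)
  also have "transpose A *v y \<in> int_vectors \<longleftrightarrow> y \<in> (*v) (transpose (matrix_inv A)) ` int_vectors" for y
  proof
    assume "transpose A *v y \<in> int_vectors"
    moreover have "y = transpose (matrix_inv A) *v (transpose A *v y)"
      by (simp only: matrix_vector_mul_assoc tinv matrix_vector_mul_lid)
    ultimately show "y \<in> (*v) (transpose (matrix_inv A)) ` int_vectors" by blast
  next
    assume "y \<in> (*v) (transpose (matrix_inv A)) ` int_vectors"
    then obtain z where "z \<in> int_vectors" "y = transpose (matrix_inv A) *v z"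
      by blast
    then show "transpose A *v y \<in> int_vectors"
      by (simp only: matrix_vector_mul_assoc tinv matrix_vector_mul_lid)
  qed
  finally show "dual_lattice ((*v) A ` int_vectors) = (*v) (transpose (matrix_inv A)) ` int_vectors"
    by blast
qed

lemma dual_lattice_basis:
  fixes L :: "(real^'n) set"
  assumes "lattice_of_rank CARD('n) L"
  obtains b where "is_lattice_basis CARD('n) b (dual_lattice L)"
    and "lattice_det (dual_lattice L) = 1 / lattice_det L"
proof -
  obtain a where a: "is_lattice_basis CARD('n) a L"
    using assms by (auto simp: lattice_of_rank_def)
  then have A: "det (basis_matrix a) \<noteq> 0" "L = (*v) (basis_matrix a) ` int_vectors"
    by (auto simp: is_lattice_basis_iff)
  obtain b where b: "basis_matrix b = transpose (matrix_inv (basis_matrix a))"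
    by (rule basis_matrix_surj)
  have B: "is_lattice_basis CARD('n) b (dual_lattice L)"
    using A dual_lattice_matrix [OF A(1)] by (simp only: is_lattice_basis_iff b) simp
  have "lattice_det (dual_lattice L) = 1 / lattice_det L"
    unfolding lattice_det_basis [OF a] lattice_det_basis [OF B] b dual_lattice_matrix(2) [OF A(1)]
    by simp
  with B show thesis by (rule that)
qed

section \<open>Packings by translates under a lattice\<close>

lemma int_vectors_diff: "x \<in> int_vectors \<Longrightarrow> y \<in> int_vectors \<Longrightarrow> x - y \<in> int_vectors"
  by (simp add: int_vectors_def)

lemma finite_int_vectors_bounded:
  fixes S :: "(real^'n) set"
  assumes "bounded S"
  shows "finite (S \<inter> int_vectors)"
proof -
  obtain B where B: "\<And>x. x \<in> S \<Longrightarrow> norm x \<le> B"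
    using assms by (auto simp: bounded_iff)
  define F :: "real set" where "F = of_int ` {- \<lceil>B\<rceil>..\<lceil>B\<rceil>}"
  have "S \<inter> int_vectors \<subseteq> {x. \<forall>i. x $ i \<in> F}"
  proof (clarify)
    fix x i assume x: "x \<in> S" "x \<in> int_vectors"
    then obtain m :: int where m: "x $ i = of_int m"
      by (auto simp: int_vectors_def elim: Ints_cases)
    have "\<bar>x $ i\<bar> \<le> B"
      using B [OF x(1)] component_le_norm_cart [of x i] by linarith
    then have "m \<in> {- \<lceil>B\<rceil>..\<lceil>B\<rceil>}"
      unfolding m by (auto simp: abs_le_iff) linarith+
    then show "x $ i \<in> F"
      unfolding F_def m by blast
  qed
  moreover have "finite {x::real^'n. \<forall>i. x $ i \<in> F}"
  proof -
    have "{x::real^'n. \<forall>i. x $ i \<in> F} \<subseteq> vec_lambda ` (UNIV \<rightarrow> F)"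
    proof
      fix x :: "real^'n" assume "x \<in> {x. \<forall>i. x $ i \<in> F}"
      then show "x \<in> vec_lambda ` (UNIV \<rightarrow> F)"
        by (intro image_eqI [of _ _ "\<lambda>i. x $ i"]) auto
    qed
    moreover have "finite (UNIV \<rightarrow> F :: ('n \<Rightarrow> real) set)"
      using finite_PiE [of "UNIV :: 'n set" "\<lambda>_. F"] by (simp add: F_def PiE_def)
    ultimately show ?thesis
      by (rule finite_subset [OF _ finite_imageI])
  qed
  ultimately show ?thesis
    by (rule finite_subset)
qed

text \<open>
  Cut \<open>S\<close> along the unit cubes with integer corners and move every piece into the cube at
  the origin. The moved pieces are disjoint because no two points of \<open>S\<close> are congruent, so their total volume is
  at most that of the cube.
\<close>

lemma measure_le_1_if_incongruent:
  fixes S :: "(real^'n) set"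
  assumes S: "S \<in> lmeasurable" and bS: "bounded S"
    and inc: "\<And>x y. x \<in> S \<Longrightarrow> y \<in> S \<Longrightarrow> x - y \<in> int_vectors \<Longrightarrow> x = y"
  shows "measure lebesgue S \<le> 1"
proof -
  define fl :: "real^'n \<Rightarrow> real^'n" where "fl x = (\<chi> i. of_int \<lfloor>x $ i\<rfloor>)" for x
  define C :: "(real^'n) set" where "C = {x. \<forall>i. x $ i \<in> {0..<1}}"
  define F where "F = fl ` S"
  define P where "P z = (+) (- z) ` S \<inter> C" for z
  have fl_int: "fl x \<in> int_vectors" and fl_C: "x - fl x \<in> C" for x
    by (auto simp: fl_def int_vectors_def C_def) linarith
  have fl_unique: "fl x = z" if "x - z \<in> C" "z \<in> int_vectors" for x z
  proof -
    have "of_int \<lfloor>x $ i\<rfloor> = z $ i" for i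
    proof -
      have "z $ i \<in> \<int>" "0 \<le> x $ i - z $ i" "x $ i - z $ i < 1"
        using that by (auto simp: C_def int_vectors_def)
      then show ?thesis
        by (auto elim!: Ints_cases) linarith
    qed
    then show ?thesis by (simp add: fl_def vec_eq_iff)
  qed
  have "convex C"
  proof -
    have "convex {x::real^'n. x $ i \<in> {0..<1}}" for i
      using convex_linear_vimage [of "\<lambda>x::real^'n. x $ i" "{0..<1}"]
      by (simp add: bounded_linear.linear [OF bounded_linear_vec_nth] vimage_def)
    then show ?thesis
      unfolding C_def Collect_all_eq by (intro convex_INT) auto
  qed
  moreover have C_sub: "C \<subseteq> cbox 0 1"
    by (auto simp: C_def mem_box_cart less_imp_le)
  ultimately have C: "C \<in> lmeasurable"
    using bounded_subset [OF bounded_cbox] by (intro measurable_convex) auto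
  have "finite F"
  proof (rule finite_subset)
    show "F \<subseteq> {u - v | u v. u \<in> S \<and> v \<in> C} \<inter> int_vectors"
    proof
      fix z assume "z \<in> F"
      then obtain x where x: "x \<in> S" "z = fl x" by (auto simp: F_def)
      then have "z = x - (x - fl x)" by simp
      then show "z \<in> {u - v | u v. u \<in> S \<and> v \<in> C} \<inter> int_vectors"
        using x(1) fl_int [of x] fl_C [of x] unfolding x(2) [symmetric] by blast
    qed
    have "{u - v | u v. u \<in> S \<and> v \<in> C} = (\<lambda>(x, y). x - y) ` (S \<times> C)"
      by auto
    then have "bounded {u - v | u v. u \<in> S \<and> v \<in> C}"
      using bounded_minus [OF bS bounded_subset [OF bounded_cbox C_sub]] by simp
    then show "finite ({u - v | u v. u \<in> S \<and> v \<in> C} \<inter> int_vectors)"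
      by (rule finite_int_vectors_bounded)
  qed
  have P: "P z \<in> lmeasurable" for z
    unfolding P_def using measurable_translation [OF S] C by (rule fmeasurable.Int)
  have piece: "measure lebesgue (S \<inter> fl -` {z}) = measure lebesgue (P z)"
    and pieceM: "S \<inter> fl -` {z} \<in> lmeasurable" if z: "z \<in> F" for z
  proof -
    have zi: "z \<in> int_vectors" using z fl_int by (auto simp: F_def)
    have eq: "S \<inter> fl -` {z} = (+) z ` P z"
    proof (intro set_eqI iffI)
      fix x assume "x \<in> S \<inter> fl -` {z}"
      then have "x - z \<in> P z" using fl_C [of x] by (auto simp: P_def image_iff)
      then show "x \<in> (+) z ` P z" by (intro image_eqI [of _ _ "x - z"]) auto
    next
      fix x assume "x \<in> (+) z ` P z"
      then show "x \<in> S \<inter> fl -` {z}"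
        using fl_unique zi by (auto simp: P_def)
    qed
    show "measure lebesgue (S \<inter> fl -` {z}) = measure lebesgue (P z)"
      unfolding eq by (rule measure_translation)
    show "S \<inter> fl -` {z} \<in> lmeasurable"
      unfolding eq using P by (rule measurable_translation)
  qed
  have "disjoint_family_on P F"
    unfolding disjoint_family_on_def
  proof (intro ballI impI, rule ccontr)
    fix z w assume zw: "z \<in> F" "w \<in> F" "z \<noteq> w" and "P z \<inter> P w \<noteq> {}"
    then obtain x y where "x \<in> S" "y \<in> S" "- z + x = - w + y"
      by (auto simp: P_def)
    moreover from this have "x - y = z - w" by (simp add: algebra_simps)
    moreover have "z - w \<in> int_vectors"
      using zw fl_int by (intro int_vectors_diff) (auto simp: F_def)
    ultimately have "x = y" using inc by metis
    then show False using \<open>x - y = z - w\<close> zw(3) by simp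
  qed
  have "S = (\<Union>z\<in>F. S \<inter> fl -` {z})"
    by (auto simp: F_def)
  then have "measure lebesgue S = measure lebesgue (\<Union>z\<in>F. S \<inter> fl -` {z})"
    by simp
  also have "\<dots> = (\<Sum>z\<in>F. measure lebesgue (S \<inter> fl -` {z}))"
    using \<open>finite F\<close> pieceM
    by (intro measure_negligible_finite_Union_image) (auto intro!: pairwiseI negligible_subset [OF negligible_empty])
  also have "\<dots> = (\<Sum>z\<in>F. measure lebesgue (P z))"
    by (intro sum.cong piece refl)
  also have "\<dots> = measure lebesgue (\<Union>z\<in>F. P z)"
    using \<open>finite F\<close> P \<open>disjoint_family_on P F\<close>
    by (intro measure_negligible_finite_Union_image [symmetric])
      (auto intro!: pairwiseI simp: disjoint_family_on_def)
  also have "\<dots> \<le> measure lebesgue (cbox 0 (1::real^'n))"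
    using \<open>finite F\<close> P C_sub by (intro measure_mono_fmeasurable sets.finite_UN) (auto simp: P_def)
  also have "\<dots> = 1"
    by (simp add: content_cbox_if_cart interval_eq_empty_cart)
  finally show ?thesis .
qed

text \<open>
  The inverse of \<open>A\<close> carries the lattice to the integer vectors and divides volumes by \<open>\<bar>det A\<bar>\<close>.
\<close>

lemma packing_measure_le_det:
  fixes A :: "real^'n^'n"
  assumes S: "S \<in> lmeasurable" and bS: "bounded S" and A: "det A \<noteq> 0"
    and inc: "\<And>x y. x \<in> S \<Longrightarrow> y \<in> S \<Longrightarrow> x - y \<in> (*v) A ` int_vectors \<Longrightarrow> x = y"
  shows "measure lebesgue S \<le> \<bar>det A\<bar>"
proof -
  obtain A' where A': "A ** A' = mat 1" "A' ** A = mat 1"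
    using A by (auto simp: invertible_det_nz [symmetric] invertible_def)
  define S' where "S' = (*v) A' ` S"
  have S_eq: "S = (*v) A ` S'"
    by (simp add: S'_def image_image matrix_vector_mul_assoc A')
  have S': "S' \<in> lmeasurable"
    unfolding S'_def using measure_matrix_image [OF S] by blast
  have "measure lebesgue S' \<le> 1"
  proof (rule measure_le_1_if_incongruent [OF S'])
    show "bounded S'"
      unfolding S'_def using bS by (intro bounded_linear_image) (simp_all add: matrix_vector_mul_bounded_linear)
    fix x y assume xy: "x \<in> S'" "y \<in> S'" "x - y \<in> int_vectors"
    have "A *v x - A *v y = A *v (x - y)"
      by (simp add: matrix_vector_mult_diff_distrib)
    then have "A *v x = A *v y"
      using xy by (intro inc) (auto simp: S_eq)
    then have "A' *v (A *v x) = A' *v (A *v y)" by simp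
    then show "x = y" by (simp add: matrix_vector_mul_assoc A')
  qed
  then show ?thesis
    using measure_matrix_image [OF S', of A] mult_left_mono [of "measure lebesgue S'" 1 "\<bar>det A\<bar>"]
    unfolding S_eq [symmetric] by simp
qed

section \<open>The width function as a norm\<close>

definition width_ball :: "(real^'n) set \<Rightarrow> real \<Rightarrow> (real^'n) set" where
  "width_ball T r = {u. width T u \<le> r}"

lemma width_attained:
  fixes T :: "(real^'n) set"
  assumes "finite T" "T \<noteq> {}"
  obtains s t where "s \<in> T" "t \<in> T" "width T u = u \<bullet> s - u \<bullet> t"
    "\<And>x. x \<in> T \<Longrightarrow> u \<bullet> t \<le> u \<bullet> x \<and> u \<bullet> x \<le> u \<bullet> s"
proof -
  let ?V = "(\<lambda>x. u \<bullet> x) ` T"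
  have V: "finite ?V" "?V \<noteq> {}" using assms by auto
  obtain s t where st: "s \<in> T" "t \<in> T" "Max ?V = u \<bullet> s" "Min ?V = u \<bullet> t"
    using Max_in [OF V] Min_in [OF V] by auto
  have "width T u = u \<bullet> s - u \<bullet> t"
    unfolding width_def st(3,4) [symmetric] using V by (simp add: cSup_eq_Max cInf_eq_Min)
  moreover have "u \<bullet> t \<le> u \<bullet> x \<and> u \<bullet> x \<le> u \<bullet> s" if "x \<in> T" for x
    unfolding st(3,4) [symmetric] using V that by (auto intro: Max_ge Min_le)
  ultimately show thesis using st that by blast
qed

text \<open>
  Turns the difference of a supremum and an infimum into a family of linear inequalities in \<open>u\<close>, indexed by
  the differences of points of \<open>T\<close>. Convexity, the norm properties and the identification with the polar body all follow from it.
\<close>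

lemma width_le_iff:
  fixes T :: "(real^'n) set"
  assumes "finite T" "T \<noteq> {}"
  shows "width T u \<le> r \<longleftrightarrow> (\<forall>s\<in>T. \<forall>t\<in>T. u \<bullet> (s - t) \<le> r)"
proof -
  obtain s t where st: "s \<in> T" "t \<in> T" "width T u = u \<bullet> s - u \<bullet> t"
    "\<And>x. x \<in> T \<Longrightarrow> u \<bullet> t \<le> u \<bullet> x \<and> u \<bullet> x \<le> u \<bullet> s"
    using width_attained [OF assms] by blast
  show ?thesis
  proof
    assume "width T u \<le> r"
    then have "u \<bullet> x - u \<bullet> y \<le> r" if "x \<in> T" "y \<in> T" for x y
      using st(3) st(4) [OF that(1)] st(4) [OF that(2)] by linarith
    then show "\<forall>s\<in>T. \<forall>t\<in>T. u \<bullet> (s - t) \<le> r"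
      by (simp add: inner_diff_right)
  next
    assume "\<forall>s\<in>T. \<forall>t\<in>T. u \<bullet> (s - t) \<le> r"
    then show "width T u \<le> r"
      using st by (simp add: inner_diff_right)
  qed
qed

lemma polar_difference_set:
  fixes T :: "(real^'n) set"
  assumes "finite T" "T \<noteq> {}"
  shows "polar (difference_set T) = width_ball T 1"
  unfolding polar_def difference_set_def width_ball_def width_le_iff [OF assms] by blast

lemma width_ge:
  fixes T :: "(real^'n) set"
  assumes "finite T" "s \<in> T" "t \<in> T"
  shows "u \<bullet> (s - t) \<le> width T u"
  using width_le_iff [of T u "width T u"] assms by auto

lemma width_diff_le:
  fixes T :: "(real^'n) set"
  assumes "finite T" "T \<noteq> {}"
  shows "width T (u - v) \<le> width T u + width T v"
  unfolding width_le_iff [OF assms]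
proof (intro ballI)
  fix s t assume "s \<in> T" "t \<in> T"
  then show "(u - v) \<bullet> (s - t) \<le> width T u + width T v"
    using width_ge [of T s t u] width_ge [of T t s v] assms(1) by (simp add: inner_diff_left inner_diff_right)
qed

lemma width_scaleR:
  fixes T :: "(real^'n) set"
  assumes T: "finite T" "T \<noteq> {}" and c: "0 \<le> c"
  shows "width T (c *\<^sub>R u) = c * width T u"
proof -
  obtain s t where st: "s \<in> T" "t \<in> T" "width T u = u \<bullet> s - u \<bullet> t"
    using width_attained [OF T] by blast
  have "width T (c *\<^sub>R u) \<le> c * width T u"
    unfolding width_le_iff [OF T] using width_ge [OF T(1), of _ _ u] c by (auto intro: mult_left_mono)
  moreover have "c * width T u \<le> width T (c *\<^sub>R u)"
    using width_ge [OF T(1) st(1,2), of "c *\<^sub>R u"] st(3)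
    by (simp add: inner_diff_right right_diff_distrib)
  ultimately show ?thesis by simp
qed

lemma convex_width_ball:
  fixes T :: "(real^'n) set"
  assumes "finite T" "T \<noteq> {}"
  shows "convex (width_ball T r)"
proof -
  have "width_ball T r = (\<Inter>s\<in>T. \<Inter>t\<in>T. {u. (s - t) \<bullet> u \<le> r})"
    by (auto simp: width_ball_def width_le_iff [OF assms] inner_commute)
  then show ?thesis by (auto intro!: convex_INT convex_halfspace_le)
qed

text \<open>
  Full dimension enters here: the convex hull of \<open>T\<close> contains a ball of some radius \<open>e\<close>, and a linear functional
  \<open>u\<close> increases by \<open>e * norm u\<close> from the centre of this ball to its boundary.
\<close>

lemma width_coercive:
  fixes T :: "(real^'n) set"
  assumes T: "finite T" "T \<noteq> {}" and full: "aff_dim T = int CARD('n)"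
  obtains e where "0 < e" "\<And>u. e * norm u \<le> width T u"
proof -
  let ?H = "convex hull T"
  have "affine hull ?H = UNIV"
    using full by (simp add: aff_dim_eq_full [symmetric] aff_dim_convex_hull)
  then have "rel_interior ?H = interior ?H"
    by (rule rel_interior_interior)
  moreover have "rel_interior ?H \<noteq> {}"
    using T by (simp add: rel_interior_eq_empty)
  ultimately obtain x e where e: "0 < e" "cball x e \<subseteq> ?H"
    by (metis all_not_in_conv mem_interior_cball)
  have bound: "u \<bullet> (y - z) \<le> width T u" if "y \<in> ?H" "z \<in> ?H" for y z u
  proof -
    obtain s t where st: "s \<in> T" "t \<in> T" "width T u = u \<bullet> s - u \<bullet> t"
      "\<And>x. x \<in> T \<Longrightarrow> u \<bullet> t \<le> u \<bullet> x \<and> u \<bullet> x \<le> u \<bullet> s"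
      using width_attained [OF T] by blast
    have "?H \<subseteq> {p. u \<bullet> p \<le> u \<bullet> s} \<inter> {p. u \<bullet> t \<le> u \<bullet> p}"
      using st(4) by (intro hull_minimal convex_Int convex_halfspace_le) (auto intro: convex_halfspace_ge)
    then have "u \<bullet> y \<le> u \<bullet> s" "u \<bullet> t \<le> u \<bullet> z"
      using that by auto
    then show ?thesis by (simp add: st(3) inner_diff_right)
  qed
  have "e * norm u \<le> width T u" for u
  proof (cases "u = 0")
    case True
    then show ?thesis
      using T width_ge [of T] by fastforce
  next
    case False
    let ?v = "(e / norm u) *\<^sub>R u"
    have "x + ?v \<in> ?H" "x \<in> ?H"
      using e False by (auto simp: dist_norm intro!: subsetD [OF e(2)])
    then have "u \<bullet> ((x + ?v) - x) \<le> width T u"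
      by (rule bound)
    moreover have "u \<bullet> ((x + ?v) - x) = e * norm u"
      using False by (simp add: dot_square_norm power2_eq_square)
    ultimately show ?thesis by simp
  qed
  with e(1) show thesis by (rule that)
qed

lemma bounded_width_ball:
  fixes T :: "(real^'n) set"
  assumes "finite T" "T \<noteq> {}" "aff_dim T = int CARD('n)"
  shows "bounded (width_ball T r)"
proof -
  obtain e where e: "0 < e" "\<And>u. e * norm u \<le> width T u"
    using width_coercive [OF assms] by blast
  have "norm u \<le> r / e" if "u \<in> width_ball T r" for u
    using e(1) order_trans [OF e(2)] that by (simp add: width_ball_def field_simps)
  then show ?thesis
    by (auto simp: bounded_iff)
qed

lemma width_ball_lmeasurable:
  fixes T :: "(real^'n) set"
  assumes "finite T" "T \<noteq> {}" "aff_dim T = int CARD('n)"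
  shows "width_ball T r \<in> lmeasurable"
  using assms by (intro measurable_convex convex_width_ball bounded_width_ball)

lemma width_ball_scaling:
  fixes T :: "(real^'n) set"
  assumes T: "finite T" "T \<noteq> {}" and r: "0 < r"
  shows "measure lebesgue (width_ball T r) = r ^ CARD('n) * measure lebesgue (width_ball T 1)"
proof -
  have "width_ball T r = (\<lambda>u. r *\<^sub>R u + 0) ` width_ball T 1"
  proof (intro set_eqI iffI)
    fix u assume "u \<in> width_ball T r"
    then have "(1 / r) *\<^sub>R u \<in> width_ball T 1"
      using r by (simp add: width_ball_def width_scaleR [OF T] field_simps)
    then show "u \<in> (\<lambda>u. r *\<^sub>R u + 0) ` width_ball T 1"
      using r by (intro image_eqI [of _ _ "(1 / r) *\<^sub>R u"]) auto
  next
    fix u assume "u \<in> (\<lambda>u. r *\<^sub>R u + 0) ` width_ball T 1"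
    then show "u \<in> width_ball T r"
      using r by (auto simp: width_ball_def width_scaleR [OF T])
  qed
  then show ?thesis
    using r measure_lebesgue_affine [of r 0 "width_ball T 1"] by simp
qed

lemma width_ball_measure_pos:
  fixes T :: "(real^'n) set"
  assumes T: "finite T" "T \<noteq> {}" and full: "aff_dim T = int CARD('n)" and r: "0 < r"
  shows "0 < measure lebesgue (width_ball T r)"
proof -
  obtain B where B: "0 < B" "\<And>t. t \<in> T \<Longrightarrow> norm t \<le> B"
    using finite_imp_bounded [OF T(1)] by (auto simp: bounded_pos)
  let ?e = "r / (2 * B)"
  have "ball 0 ?e \<subseteq> width_ball T r"
  proof
    fix u :: "real^'n" assume "u \<in> ball 0 ?e"
    then have u: "norm u \<le> ?e" by simp
    have "u \<bullet> (s - t) \<le> r" if "s \<in> T" "t \<in> T" for s t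
    proof -
      have "u \<bullet> (s - t) \<le> norm u * norm (s - t)"
        by (rule norm_cauchy_schwarz)
      also have "norm (s - t) \<le> 2 * B"
        using B(2) [OF that(1)] B(2) [OF that(2)] norm_triangle_ineq4 [of s t] by linarith
      then have "norm u * norm (s - t) \<le> ?e * (2 * B)"
        using u r B(1) by (intro mult_mono) auto
      finally show ?thesis using B by simp
    qed
    then show "u \<in> width_ball T r"
      by (simp add: width_ball_def width_le_iff [OF T])
  qed
  then have "measure lebesgue (ball 0 ?e :: (real^'n) set) \<le> measure lebesgue (width_ball T r)"
    using width_ball_lmeasurable [OF T full] by (intro measure_mono_fmeasurable) auto
  moreover have "0 < measure lebesgue (ball 0 ?e :: (real^'n) set)"
    using B r by (simp add: content_ball_pos)
  ultimately show ?thesis by linarith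
qed

section \<open>Tilings force dual vectors to have large width\<close>

lemma lattice_closed:
  assumes "lattice_of_rank CARD('n) (L :: (real^'n) set)"
  shows "0 \<in> L" "x \<in> L \<Longrightarrow> y \<in> L \<Longrightarrow> x - y \<in> L"
proof -
  obtain b where L: "L = (*v) (basis_matrix b) ` int_vectors"
    using assms by (auto simp: lattice_of_rank_def is_lattice_basis_iff)
  show "0 \<in> L"
    unfolding L by (intro image_eqI [of _ _ 0]) (auto simp: int_vectors_def)
  show "x - y \<in> L" if "x \<in> L" "y \<in> L"
    using that unfolding L
    by (auto simp: matrix_vector_mult_diff_distrib [symmetric] intro!: imageI int_vectors_diff)
qed

text \<open>
  The tiling property \<open>M = L + T\<close> enters here. Doubling the longest step in direction \<open>u\<close> that \<open>T\<close> allows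
  leads to a point of \<open>M\<close> that no tile \<open>l + T\<close> can contain if the width is less than 1/2.
\<close>

lemma dual_vector_width_ge_half:
  fixes M L T :: "(real^'n) set"
  assumes triple: "(M, L, T) \<in> tiling_triples" and full: "aff_dim T = int CARD('n)"
    and u: "u \<in> dual_lattice L" "u \<noteq> 0"
  shows "1 / 2 \<le> width T u"
proof (rule ccontr)
  assume "\<not> 1 / 2 \<le> width T u"
  then have small: "width T u < 1 / 2" by simp
  have T: "finite T" "T \<noteq> {}" and M: "lattice_of_rank CARD('n) M" and L: "lattice_of_rank CARD('n) L"
    and MLT: "M = L + T"
    using triple by (auto simp: tiling_triples_def)
  obtain e where "0 < e" "\<And>u. e * norm u \<le> width T u"
    using width_coercive [OF T full] by blast
  then have pos: "0 < width T u"
    using u(2) by (metis mult_pos_pos order_less_le_trans zero_less_norm_iff)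
  obtain s t where st: "s \<in> T" "t \<in> T" "width T u = u \<bullet> s - u \<bullet> t"
    "\<And>x. x \<in> T \<Longrightarrow> u \<bullet> t \<le> u \<bullet> x \<and> u \<bullet> x \<le> u \<bullet> s"
    using width_attained [OF T] by blast
  have "T \<subseteq> M"
    unfolding MLT using lattice_closed(1) [OF L] by (rule set_zero_plus2)
  then have "s - (t - s) \<in> M"
    using st by (intro lattice_closed(2) [OF M]) auto
  then obtain l x where lx: "l \<in> L" "x \<in> T" "s - (t - s) = l + x"
    unfolding MLT by (auto elim: set_plus_elim)
  have "u \<bullet> s - (u \<bullet> t - u \<bullet> s) = u \<bullet> l + u \<bullet> x"
    using arg_cong [OF lx(3), of "(\<bullet>) u"] by (simp only: inner_diff_right inner_add_right)
  then have "u \<bullet> l = u \<bullet> t + 2 * width T u - u \<bullet> x"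
    using st(3) by simp
  moreover obtain m :: int where "u \<bullet> l = of_int m"
    using u(1) lx(1) by (auto simp: dual_lattice_def elim: Ints_cases)
  moreover have "0 \<le> u \<bullet> x - u \<bullet> t" "u \<bullet> x - u \<bullet> t \<le> width T u"
    using st(3) st(4) [OF lx(2)] by auto
  ultimately have "0 < m" "m < 1"
    using pos small by linarith+
  then show False by simp
qed

section \<open>The number of width vectors and the volumes\<close>

lemma width_vectors_iff:
  "u \<in> width_vectors T L \<longleftrightarrow> u \<in> dual_lattice L \<and> u \<noteq> 0 \<and> width T u < 1"
  by (auto simp: width_vectors_def)

text \<open>
  The map \<open>res\<close> below is the class modulo \<open>4\<Lambda>\<close>, read off from coordinates. It is injective because a difference of
  two vectors of width less than 1, divided by 4, has width less than 1/2. Including 0 among the vectors makes the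
  bound on their number strict.
\<close>

lemma width_vectors_count:
  fixes M L T :: "(real^'n) set"
  assumes triple: "(M, L, T) \<in> tiling_triples" and full: "aff_dim T = int CARD('n)"
  shows "finite (width_vectors T L)" "card (width_vectors T L) < 4 ^ CARD('n)"
proof -
  let ?W = "width_vectors T L"
  have T: "finite T" "T \<noteq> {}" and L: "lattice_of_rank CARD('n) L"
    using triple by (auto simp: tiling_triples_def)
  obtain b where b: "is_lattice_basis CARD('n) b (dual_lattice L)"
    using dual_lattice_basis [OF L] by blast
  define B where "B = basis_matrix b"
  have dual: "dual_lattice L = (*v) B ` int_vectors" and "det B \<noteq> 0"
    using b by (auto simp: is_lattice_basis_iff B_def)
  then obtain B' where B': "B ** B' = mat 1" "B' ** B = mat 1"
    by (auto simp: invertible_det_nz [symmetric] invertible_def)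
  define res :: "real^'n \<Rightarrow> 'n \<Rightarrow> int" where "res x i = \<lfloor>(B' *v x) $ i\<rfloor> mod 4" for x i
  have w0: "width T 0 = 0"
    using width_scaleR [OF T, of 0 0] by simp
  have "inj_on res (insert 0 ?W)"
  proof (rule inj_onI)
    fix x y assume xy: "x \<in> insert 0 ?W" "y \<in> insert 0 ?W" "res x = res y"
    have xd: "x \<in> dual_lattice L" "width T x < 1" and yd: "y \<in> dual_lattice L" "width T y < 1"
      using xy w0 by (auto simp: width_vectors_iff dual_lattice_def)
    have coord: "\<exists>z\<in>int_vectors. v = B *v z \<and> B' *v v = z" if "v \<in> dual_lattice L" for v
      using that by (auto simp: dual matrix_vector_mul_assoc B')
    obtain p q where p: "p \<in> int_vectors" "x = B *v p" "B' *v x = p"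
      and q: "q \<in> int_vectors" "y = B *v q" "B' *v y = q"
      using coord [OF xd(1)] coord [OF yd(1)] by blast
    have "((1 / 4) *\<^sub>R (p - q)) $ i \<in> \<int>" for i
    proof -
      have "p $ i \<in> \<int>" "q $ i \<in> \<int>"
        using p(1) q(1) by (auto simp: int_vectors_def)
      then obtain k l :: int where kl: "p $ i = of_int k" "q $ i = of_int l"
        by (metis Ints_cases)
      have "k mod 4 = l mod 4"
        using fun_cong [OF xy(3), of i] by (simp add: res_def p(3) q(3) kl)
      then obtain m where "k - l = 4 * m"
        by (auto simp: mod_eq_dvd_iff)
      then have "(1 / 4) * (p $ i - q $ i) = of_int m"
        unfolding kl by (simp flip: of_int_diff)
      then show ?thesis by simp
    qed
    then have "(1 / 4) *\<^sub>R (x - y) \<in> dual_lattice L"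
      unfolding dual p(2) q(2) matrix_vector_mult_diff_distrib [symmetric] matrix_vector_mult_scaleR [symmetric]
      by (intro imageI) (simp add: int_vectors_def)
    moreover have "width T ((1 / 4) *\<^sub>R (x - y)) < 1 / 2"
      using width_diff_le [OF T, of x y] xd(2) yd(2) by (simp add: width_scaleR [OF T])
    ultimately have "(1 / 4) *\<^sub>R (x - y) = 0"
      using dual_vector_width_ge_half [OF triple full, of "(1 / 4) *\<^sub>R (x - y)"] by linarith
    then show "x = y" by simp
  qed
  moreover have "res ` insert 0 ?W \<subseteq> UNIV \<rightarrow>\<^sub>E {0..<4}"
    by (auto simp: res_def)
  moreover have fin: "finite (UNIV \<rightarrow>\<^sub>E {0..<4} :: ('n \<Rightarrow> int) set)"
    by (intro finite_PiE) auto
  ultimately have fW: "finite (insert 0 ?W)"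
    and "card (insert 0 ?W) \<le> card (UNIV \<rightarrow>\<^sub>E {0..<4} :: ('n \<Rightarrow> int) set)"
    by (blast intro: inj_on_finite, blast intro: card_inj_on_le)
  then have "card (insert 0 ?W) \<le> 4 ^ CARD('n)"
    by (simp add: card_PiE)
  moreover have "0 \<notin> ?W"
    by (simp add: width_vectors_iff)
  ultimately show "finite ?W" "card ?W < 4 ^ CARD('n)"
    using fW by auto
qed

text \<open>
  The balls of radius less than 1/4 give a packing; their volumes are compared with \<open>det \<Lambda>\<close>,
  and the radius then tends to 1/4.
\<close>

lemma polar_volume_bound:
  fixes M L T :: "(real^'n) set"
  assumes triple: "(M, L, T) \<in> tiling_triples" and full: "aff_dim T = int CARD('n)"
  shows "vol (polar (difference_set T)) \<le> 4 ^ CARD('n) * lattice_det (dual_lattice L)"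
proof -
  have T: "finite T" "T \<noteq> {}" and L: "lattice_of_rank CARD('n) L"
    using triple by (auto simp: tiling_triples_def)
  obtain b where b: "is_lattice_basis CARD('n) b (dual_lattice L)"
    using dual_lattice_basis [OF L] by blast
  have dual: "dual_lattice L = (*v) (basis_matrix b) ` int_vectors" "det (basis_matrix b) \<noteq> 0"
    using b by (auto simp: is_lattice_basis_iff)
  let ?V = "vol (width_ball T 1)" and ?D = "lattice_det (dual_lattice L)"
  have le: "r ^ CARD('n) * ?V \<le> 4 ^ CARD('n) * ?D" if r: "0 < r" "r < 1" for r
  proof -
    have "vol (width_ball T (r / 4)) \<le> \<bar>det (basis_matrix b)\<bar>"
    proof (rule packing_measure_le_det [OF width_ball_lmeasurable [OF T full] bounded_width_ball [OF T full] dual(2)])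
      fix x y assume xy: "x \<in> width_ball T (r / 4)" "y \<in> width_ball T (r / 4)"
        "x - y \<in> (*v) (basis_matrix b) ` int_vectors"
      have "width T (x - y) < 1 / 2"
        using width_diff_le [OF T, of x y] xy r by (simp add: width_ball_def)
      then show "x = y"
        using dual_vector_width_ge_half [OF triple full, of "x - y"] xy(3) dual(1) by force
    qed
    then have "(r / 4) ^ CARD('n) * ?V \<le> ?D"
      using r width_ball_scaling [OF T, of "r / 4"] by (simp add: lattice_det_basis [OF b])
    then show ?thesis
      by (simp add: power_divide field_simps)
  qed
  have "((\<lambda>r. r ^ CARD('n) * ?V) \<longlongrightarrow> 1 ^ CARD('n) * ?V) (at_left 1)"
    by (intro tendsto_intros)
  moreover have "eventually (\<lambda>r. r ^ CARD('n) * ?V \<le> 4 ^ CARD('n) * ?D) (at_left (1::real))"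
    using eventually_at_left_real [of 0 "1::real"] by (auto elim!: eventually_mono intro: le)
  ultimately have "1 ^ CARD('n) * ?V \<le> 4 ^ CARD('n) * ?D"
    by (intro tendsto_upperbound) auto
  then show ?thesis
    by (simp add: polar_difference_set [OF T])
qed

lemma width_vectors_hull_volume:
  fixes L T :: "(real^'n) set"
  assumes T: "finite T" "T \<noteq> {}" and full: "aff_dim T = int CARD('n)"
    and fin: "finite (width_vectors T L)"
  shows "vol (convex hull (width_vectors T L)) < vol (polar (difference_set T))"
proof -
  let ?W = "width_vectors T L"
  \<comment> \<open>The inserted 1/2 only makes \<open>r\<close> positive and keeps the maximum defined when there are no width vectors.\<close>
  define r where "r = Max (insert (1 / 2) (width T ` ?W))"
  have r: "0 < r" "r < 1"
    using fin by (auto simp: r_def Max_gr_iff width_vectors_iff)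
  have "?W \<subseteq> width_ball T r"
    using fin by (auto simp: r_def width_ball_def)
  then have "convex hull ?W \<subseteq> width_ball T r"
    by (intro hull_minimal convex_width_ball [OF T])
  then have "vol (convex hull ?W) \<le> vol (width_ball T r)"
    using fin width_ball_lmeasurable [OF T full]
    by (intro measure_mono_fmeasurable) (auto intro!: fmeasurableD lmeasurable_compact finite_imp_compact_convex_hull)
  also have "\<dots> = r ^ CARD('n) * vol (width_ball T 1)"
    by (rule width_ball_scaling [OF T r(1)])
  also have "\<dots> < 1 * vol (width_ball T 1)"
    using r width_ball_measure_pos [OF T full, of 1]
    by (intro mult_strict_right_mono) (auto intro: power_Suc_less_one simp: power_less_one_iff)
  finally show ?thesis
    by (simp add: polar_difference_set [OF T])
qed

section \<open>The volume of the cross-polytope\<close>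

lemma measure_std_simplex_cart:
  defines "D \<equiv> {x::real^'n. (\<forall>i. 0 \<le> x $ i) \<and> (\<Sum>i\<in>UNIV. x $ i) \<le> 1}"
  shows "D \<in> lmeasurable" "measure lebesgue D = 1 / fact CARD('n)"
proof -
  have B: "Basis = (\<lambda>i. axis i (1::real)) ` (UNIV :: 'n set)"
    by (auto simp: Basis_vec_def)
  have inj: "inj (\<lambda>i::'n. axis i (1::real))"
    by (auto simp: inj_on_def axis_eq_axis)
  have "(\<Sum>b\<in>Basis. x \<bullet> b) = (\<Sum>i\<in>UNIV. x $ i)" for x :: "real^'n"
    unfolding B by (subst sum.reindex [OF inj]) (simp add: inner_axis)
  then have eq: "convex hull (insert 0 Basis) = D"
    unfolding std_simplex D_def by (simp add: B inner_axis)
  have comp: "compact (convex hull (insert 0 Basis) :: (real^'n) set)"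
    by (intro finite_imp_compact_convex_hull) simp
  then show "D \<in> lmeasurable"
    unfolding eq by (rule lmeasurable_compact)
  have "measure lebesgue (convex hull (insert 0 Basis) :: (real^'n) set) = 1 / fact CARD('n)"
    using content_std_simplex [where 'a="real^'n"] comp
    by (simp add: measure_completion borel_compact)
  then show "measure lebesgue D = 1 / fact CARD('n)"
    unfolding eq .
qed

text \<open>
  Each of the \<open>2^d\<close> orthants cuts out of the cross-polytope a reflected copy \<open>F \<sigma>\<close> of the standard simplex, where
  \<open>\<sigma>\<close> is the set of coordinates whose sign is reversed. Distinct copies meet only inside a coordinate hyperplane.
\<close>

lemma measure_cross_polytope:
  defines "X \<equiv> {x::real^'n. (\<Sum>i\<in>UNIV. \<bar>x $ i\<bar>) \<le> 1}"
  shows "X \<in> lmeasurable" "measure lebesgue X = 2 ^ CARD('n) / fact CARD('n)"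
proof -
  define D where "D = {x::real^'n. (\<forall>i. 0 \<le> x $ i) \<and> (\<Sum>i\<in>UNIV. x $ i) \<le> 1}"
  note D = measure_std_simplex_cart [where 'n='n, folded D_def]
  define e :: "'n set \<Rightarrow> 'n \<Rightarrow> real" where "e \<sigma> i = (if i \<in> \<sigma> then - 1 else 1)" for \<sigma> i
  define F where "F \<sigma> = (\<lambda>x::real^'n. \<chi> i. e \<sigma> i * x $ i) ` D" for \<sigma>
  have ee: "e \<sigma> i * (e \<sigma> i * t) = t" "\<bar>e \<sigma> i\<bar> = 1" for \<sigma> i t
    by (auto simp: e_def)
  have F_eq: "F \<sigma> = {x. (\<forall>i. 0 \<le> e \<sigma> i * x $ i) \<and> (\<Sum>i\<in>UNIV. \<bar>x $ i\<bar>) \<le> 1}" for \<sigma>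
  proof (intro set_eqI iffI)
    fix x assume "x \<in> F \<sigma>"
    then obtain y where y: "y \<in> D" "x = (\<chi> i. e \<sigma> i * y $ i)"
      by (auto simp: F_def)
    then have "(\<Sum>i\<in>UNIV. \<bar>x $ i\<bar>) = (\<Sum>i\<in>UNIV. y $ i)"
      by (intro sum.cong) (auto simp: D_def abs_mult ee)
    then show "x \<in> {x. (\<forall>i. 0 \<le> e \<sigma> i * x $ i) \<and> (\<Sum>i\<in>UNIV. \<bar>x $ i\<bar>) \<le> 1}"
      using y by (simp add: D_def ee)
  next
    fix x assume x: "x \<in> {x. (\<forall>i. 0 \<le> e \<sigma> i * x $ i) \<and> (\<Sum>i\<in>UNIV. \<bar>x $ i\<bar>) \<le> 1}"
    have "e \<sigma> i * x $ i = \<bar>x $ i\<bar>" for i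
    proof -
      have "0 \<le> e \<sigma> i * x $ i" using x by blast
      then show ?thesis by (auto simp: e_def split: if_splits)
    qed
    then have "(\<chi> i. e \<sigma> i * x $ i) \<in> D"
      using x by (simp add: D_def)
    then show "x \<in> F \<sigma>"
      unfolding F_def by (rule rev_image_eqI) (simp add: vec_eq_iff ee)
  qed
  have F: "F \<sigma> \<in> lmeasurable" "measure lebesgue (F \<sigma>) = 1 / fact CARD('n)" for \<sigma>
    using measurable_stretch [OF D(1), of "e \<sigma>"] measure_stretch [OF D(1), of "e \<sigma>"]
    by (simp_all add: F_def D(2) abs_prod ee)
  have negl: "negligible (F \<sigma> \<inter> F \<tau>)" if ne: "\<sigma> \<noteq> \<tau>" for \<sigma> \<tau>
  proof -
    obtain i where "(i \<in> \<sigma>) \<noteq> (i \<in> \<tau>)"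
      using ne by (auto simp: set_eq_iff)
    then have "F \<sigma> \<inter> F \<tau> \<subseteq> {x. x $ i = 0}"
      unfolding F_eq by (auto simp: e_def dest!: spec [of _ i])
    then show ?thesis
      by (rule negligible_subset [OF negligible_standard_hyperplane_cart])
  qed
  have X: "X = (\<Union>\<sigma>\<in>UNIV. F \<sigma>)"
  proof (intro set_eqI iffI)
    fix x assume "x \<in> X"
    then have "x \<in> F {i. x $ i < 0}"
      by (auto simp: F_eq X_def e_def)
    then show "x \<in> (\<Union>\<sigma>\<in>UNIV. F \<sigma>)" by blast
  qed (auto simp: F_eq X_def)
  show "X \<in> lmeasurable"
    unfolding X using F by (intro fmeasurable.finite_UN) auto
  have "measure lebesgue X = (\<Sum>\<sigma>\<in>UNIV. measure lebesgue (F \<sigma>))"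
    unfolding X using F negl by (intro measure_negligible_finite_Union_image) (auto simp: pairwise_def)
  also have "\<dots> = 2 ^ CARD('n) / fact CARD('n)"
    by (simp add: F card_UNIV_set)
  finally show "measure lebesgue X = 2 ^ CARD('n) / fact CARD('n)" .
qed

section \<open>Triangular bases of a lattice\<close>

text \<open>
  The index type is ordered through the injection \<open>f\<close>. Permuting the indices does not change the sum of all values of
  \<open>f\<close>, so a permutation that decreases \<open>f\<close> nowhere is the identity; every other one picks a zero entry below the diagonal.
\<close>

lemma det_triangular:
  fixes A :: "real^'n^'n" and f :: "'n \<Rightarrow> nat"
  assumes inj: "inj f" and zero: "\<And>i j. f j < f i \<Longrightarrow> A $ i $ j = 0"
  shows "det A = (\<Prod>i\<in>UNIV. A $ i $ i)"
proof -
  have "(\<Prod>i\<in>UNIV. A $ i $ p i) = 0" if p: "p permutes UNIV" "p \<noteq> id" for p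
  proof -
    have "\<exists>i. f (p i) < f i"
    proof (rule ccontr)
      assume "\<not> (\<exists>i. f (p i) < f i)"
      then have ge: "f i \<le> f (p i)" for i
        by (simp add: not_less)
      have "(\<Sum>i\<in>UNIV. f (p i)) = (\<Sum>i\<in>UNIV. f i)"
        using sum.permute [OF p(1), of f] by (simp add: o_def)
      then have "f (p i) = f i" for i
        using sum_strict_mono_ex1 [of UNIV f "\<lambda>i. f (p i)"] ge
        by (metis finite iso_tuple_UNIV_I le_neq_implies_less less_irrefl)
      then show False
        using p(2) inj by (metis eq_id_iff injD)
    qed
    then show ?thesis
      by (metis (no_types, lifting) zero prod_zero finite iso_tuple_UNIV_I)
  qed
  then have "det A = (\<Sum>p\<in>{id}. of_int (sign p) * (\<Prod>i\<in>UNIV. A $ i $ p i))"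
    unfolding det_def by (intro sum.mono_neutral_right) (auto simp: permutes_id finite_permutations)
  then show ?thesis by simp
qed

lemma one_plus_sum_le_prod:
  fixes a :: "'i \<Rightarrow> int"
  assumes "finite I" "\<And>i. i \<in> I \<Longrightarrow> 1 \<le> a i"
  shows "1 + (\<Sum>i\<in>I. a i - 1) \<le> (\<Prod>i\<in>I. a i)"
  using assms
proof (induction I rule: finite_induct)
  case (insert j I)
  have "0 \<le> (a j - 1) * ((\<Prod>i\<in>I. a i) - 1)"
  proof (intro mult_nonneg_nonneg)
    have "1 \<le> a j" by (rule insert.prems) simp
    then show "0 \<le> a j - 1" by simp
    have "1 \<le> (\<Prod>i\<in>I. a i)" by (rule prod_ge_1) (simp add: insert.prems)
    then show "0 \<le> (\<Prod>i\<in>I. a i) - 1" by simp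
  qed
  then have "a j - 1 + (\<Prod>i\<in>I. a i) \<le> a j * (\<Prod>i\<in>I. a i)"
    by (simp add: algebra_simps)
  moreover have "1 + (\<Sum>i\<in>I. a i - 1) \<le> (\<Prod>i\<in>I. a i)"
    using insert by simp
  ultimately show ?case
    using insert.hyps by simp
qed simp

lemma subgroup_int_combination:
  fixes \<Lambda> :: "'a::real_vector set"
  assumes z: "0 \<in> \<Lambda>" and diff: "\<forall>x\<in>\<Lambda>. \<forall>y\<in>\<Lambda>. x - y \<in> \<Lambda>"
  shows "x \<in> \<Lambda> \<Longrightarrow> y \<in> \<Lambda> \<Longrightarrow> x + y \<in> \<Lambda>"
    and "x \<in> \<Lambda> \<Longrightarrow> of_int m *\<^sub>R x \<in> \<Lambda>"
    and "(\<And>i. i \<in> I \<Longrightarrow> f i \<in> \<Lambda>) \<Longrightarrow> sum f I \<in> \<Lambda>"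
proof -
  note d = diff [rule_format]
  have minus: "- x \<in> \<Lambda>" if "x \<in> \<Lambda>" for x
    using d [OF z that] by simp
  show add: "x + y \<in> \<Lambda>" if "x \<in> \<Lambda>" "y \<in> \<Lambda>" for x y
    using d [OF that(1) minus [OF that(2)]] by simp
  show "of_int m *\<^sub>R x \<in> \<Lambda>" if "x \<in> \<Lambda>"
  proof -
    have nat: "of_nat n *\<^sub>R x \<in> \<Lambda>" for n
      by (induction n) (auto simp: z scaleR_add_left that add)
    show ?thesis
    proof (cases "0 \<le> m")
      case True
      then show ?thesis using nat [of "nat m"] by simp
    next
      case False
      then show ?thesis using minus [OF nat [of "nat (- m)"]] by simp
    qed
  qed
  show "sum f I \<in> \<Lambda>" if "\<And>i. i \<in> I \<Longrightarrow> f i \<in> \<Lambda>"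
    using that by (induction I rule: infinite_finite_induct) (auto simp: z add)
qed

text \<open>
  The Hermite normal form of \<open>u\<close> relative to the lattice \<open>\<Lambda>\<close>, where \<open>b\<close> spans the part of \<open>\<Lambda>\<close> inside the
  span of \<open>u\<close>. The hypothesis on \<open>N\<close> says that coordinates with respect to \<open>u\<close> of points of \<open>\<Lambda>\<close> have a common
  denominator; in particular they are unique. The induction adds one vector at a time: the last coordinates of
  points of \<open>\<Lambda>\<close> form a cyclic group, a generator of it is realised by some point of \<open>\<Lambda>\<close>, and this point is then reduced by the
  earlier basis vectors so that the off-diagonal entries become remainders modulo the new diagonal entry.
\<close>

lemma triangular_lattice_basis:
  fixes \<Lambda> :: "'a::real_vector set" and u :: "nat \<Rightarrow> 'a" and N :: int
  assumes z: "0 \<in> \<Lambda>" and diff: "\<forall>x\<in>\<Lambda>. \<forall>y\<in>\<Lambda>. x - y \<in> \<Lambda>" and N: "0 < N"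
    and u: "\<forall>i\<in>{1..r}. u i \<in> \<Lambda>"
    and int: "\<forall>c. (\<Sum>i\<in>{1..r}. c i *\<^sub>R u i) \<in> \<Lambda> \<longrightarrow> (\<forall>i\<in>{1..r}. of_int N * c i \<in> \<int>)"
  shows "\<exists>b (a :: nat \<Rightarrow> nat \<Rightarrow> int).
    (\<forall>i\<in>{1..r}. b i \<in> \<Lambda> \<and> u i = (\<Sum>k\<in>{1..i}. of_int (a i k) *\<^sub>R b k) \<and> 1 \<le> a i i \<and>
        (\<forall>k\<in>{1..<i}. 0 \<le> a i k \<and> a i k < a i i)) \<and>
    (\<forall>c. (\<Sum>i\<in>{1..r}. c i *\<^sub>R u i) \<in> \<Lambda> \<longrightarrow>
        (\<exists>m::nat \<Rightarrow> int. (\<Sum>i\<in>{1..r}. c i *\<^sub>R u i) = (\<Sum>i\<in>{1..r}. of_int (m i) *\<^sub>R b i)))"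
  using u int
proof (induction r)
  case 0
  show ?case by simp
next
  case (Suc r)
  note comb = subgroup_int_combination [OF z diff] and d = diff [rule_format]
  note uS = bspec [OF Suc.prems(1)] and intS = mp [OF spec [OF Suc.prems(2)]]
  have "\<forall>i\<in>{1..r}. of_int N * c i \<in> \<int>" if "(\<Sum>i\<in>{1..r}. c i *\<^sub>R u i) \<in> \<Lambda>" for c
  proof -
    have eq: "(\<Sum>i\<in>{1..Suc r}. (c(Suc r := 0)) i *\<^sub>R u i) = (\<Sum>i\<in>{1..r}. c i *\<^sub>R u i)"
      by (simp add: sum.cl_ivl_Suc)
    have *: "\<forall>i\<in>{1..Suc r}. of_int N * (c(Suc r := 0)) i \<in> \<int>"
      by (rule intS) (simp only: eq that)
    show ?thesis
    proof
      fix i assume "i \<in> {1..r}"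
      then show "of_int N * c i \<in> \<int>" using bspec [OF *, of i] by simp
    qed
  qed
  then have int': "\<forall>c. (\<Sum>i\<in>{1..r}. c i *\<^sub>R u i) \<in> \<Lambda> \<longrightarrow> (\<forall>i\<in>{1..r}. of_int N * c i \<in> \<int>)"
    by blast
  have u': "\<forall>i\<in>{1..r}. u i \<in> \<Lambda>"
    using Suc.prems(1) by simp
  from Suc.IH [OF u' int'] obtain b and a :: "nat \<Rightarrow> nat \<Rightarrow> int" where
    ba0: "\<forall>i\<in>{1..r}. b i \<in> \<Lambda> \<and> u i = (\<Sum>k\<in>{1..i}. of_int (a i k) *\<^sub>R b k) \<and> 1 \<le> a i i \<and>
        (\<forall>k\<in>{1..<i}. 0 \<le> a i k \<and> a i k < a i i)"
    and gen0: "\<forall>c. (\<Sum>i\<in>{1..r}. c i *\<^sub>R u i) \<in> \<Lambda> \<longrightarrow>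
        (\<exists>m::nat \<Rightarrow> int. (\<Sum>i\<in>{1..r}. c i *\<^sub>R u i) = (\<Sum>i\<in>{1..r}. of_int (m i) *\<^sub>R b i))"
    by (elim exE conjE) (rule that)
  note ba = bspec [OF ba0] and gen = mp [OF spec [OF gen0]]
  define lc where "lc c = (\<Sum>i\<in>{1..Suc r}. c i *\<^sub>R u i)" for c :: "nat \<Rightarrow> real"
  have lc_diff: "lc c - of_int m *\<^sub>R lc c' = lc (\<lambda>i. c i - of_int m * c' i)" for c c' m
    by (simp only: lc_def scaleR_sum_right sum_subtractf [symmetric] scaleR_diff_left scaleR_scaleR)
  have lc_int: "of_int N * c (Suc r) \<in> \<int>" if "lc c \<in> \<Lambda>" for c
    using intS [of c] that by (simp add: lc_def)
  have lc_gen: "\<exists>m::nat \<Rightarrow> int. lc c = (\<Sum>i\<in>{1..r}. of_int (m i) *\<^sub>R b i)" if "lc c \<in> \<Lambda>" "c (Suc r) = 0" for c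
    using gen [of c] that by (simp add: lc_def)
  define e where "e = (\<lambda>i. if i = Suc r then 1 else (0::real))"
  have "(\<Sum>i\<in>{1..r}. e i *\<^sub>R u i) = 0"
    by (intro sum.neutral) (auto simp: e_def)
  then have lc_e: "lc e = u (Suc r)"
    by (simp add: lc_def e_def)
  \<comment> \<open>\<open>p / N\<close> is the least positive last coordinate of a point of \<open>\<Lambda>\<close>; division with remainder
    shows that it generates all of them.\<close>
  define Q where "Q p \<longleftrightarrow> 0 < p \<and> (\<exists>c. lc c \<in> \<Lambda> \<and> of_int N * c (Suc r) = real p)" for p :: nat
  define p where "p = (LEAST p. Q p)"
  have "Q (nat N)"
    unfolding Q_def using N uS [of "Suc r"] by (auto intro!: exI [of _ e] simp: lc_e) (simp add: e_def)
  then have "Q p"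
    unfolding p_def by (rule LeastI)
  then obtain cv where p: "0 < p" and cv: "lc cv \<in> \<Lambda>" "of_int N * cv (Suc r) = real p"
    by (auto simp: Q_def)
  have p_dvd: "\<exists>s. of_int N * c (Suc r) = of_int s * real p" if c: "lc c \<in> \<Lambda>" for c
  proof -
    obtain q :: int where q: "of_int N * c (Suc r) = of_int q"
      using lc_int [OF c] by (auto elim: Ints_cases)
    define c' where "c' = (\<lambda>i. c i - of_int (q div int p) * cv i)"
    have "lc c' \<in> \<Lambda>"
      unfolding c'_def lc_diff [symmetric] by (intro d c comb(2) cv(1))
    moreover have "of_int N * c' (Suc r) = of_int q - of_int (q div int p) * real p"
      unfolding c'_def using q cv(2) by (simp add: algebra_simps)
    then have "of_int N * c' (Suc r) = of_int (q - q div int p * int p)"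
      by simp
    then have "of_int N * c' (Suc r) = real (nat (q mod int p))"
      using p by (simp add: minus_div_mult_eq_mod)
    moreover have "nat (q mod int p) < p"
      using p by (simp add: nat_less_iff)
    then have "\<not> Q (nat (q mod int p))"
      unfolding p_def by (rule not_less_Least)
    ultimately have "q mod int p = 0"
      unfolding Q_def using p by (metis Euclidean_Rings.pos_mod_sign nat_eq_iff2 neq0_conv not_le of_nat_0_less_iff of_nat_0 order_antisym pos_mod_sign)
    then have "q = q div int p * int p"
      by (metis add.right_neutral div_mult_mod_eq)
    then show ?thesis
      using q by (metis of_int_mult of_int_of_nat_eq)
  qed
  \<comment> \<open>The last coordinate 1 of \<open>u (Suc r)\<close> is \<open>A\<close> times the generator; this \<open>A\<close> is the new diagonal entry.\<close>
  obtain A :: int where "of_int N * e (Suc r) = of_int A * real p"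
    using p_dvd [of e] uS [of "Suc r"] by (auto simp: lc_e)
  then have A: "real_of_int N = of_int A * real p"
    by (simp add: e_def)
  then have A_pos: "0 < A"
    using N p by (metis of_int_0_less_iff of_nat_0_less_iff zero_less_mult_pos2)
  define v where "v = lc cv"
  have cv_Suc: "of_int A * cv (Suc r) = 1"
    using cv(2) p unfolding A by (simp add: mult.assoc mult.left_commute)
  have "u (Suc r) - of_int A *\<^sub>R v = lc (\<lambda>i. e i - of_int A * cv i)"
    unfolding v_def lc_e [symmetric] by (rule lc_diff)
  moreover have "u (Suc r) - of_int A *\<^sub>R v \<in> \<Lambda>"
    unfolding v_def by (intro d comb(2) cv(1) uS) simp
  ultimately obtain m :: "nat \<Rightarrow> int"
    where m: "u (Suc r) - of_int A *\<^sub>R v = (\<Sum>i\<in>{1..r}. of_int (m i) *\<^sub>R b i)"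
    using lc_gen [of "\<lambda>i. e i - of_int A * cv i"] cv_Suc by (auto simp: e_def)
  \<comment> \<open>Moving the quotients \<open>m i div A\<close> into the new basis vector leaves the remainders as entries of the new row.\<close>
  define w where "w = v + (\<Sum>i\<in>{1..r}. of_int (m i div A) *\<^sub>R b i)"
  define b' where "b' = b(Suc r := w)"
  define a' where "a' = a(Suc r := (\<lambda>k. if k = Suc r then A else m k mod A))"
  have old: "(\<Sum>i\<in>{1..j}. f i *\<^sub>R b' i) = (\<Sum>i\<in>{1..j}. f i *\<^sub>R b i)" if "j \<le> r" for j f
    using that by (intro sum.cong) (auto simp: b'_def)
  have w: "w \<in> \<Lambda>"
    unfolding w_def v_def by (intro comb cv(1)) (use ba in auto)
  have new: "u (Suc r) = (\<Sum>k\<in>{1..Suc r}. of_int (a' (Suc r) k) *\<^sub>R b' k)"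
  proof -
    have "(\<Sum>k\<in>{1..Suc r}. of_int (a' (Suc r) k) *\<^sub>R b' k)
        = (\<Sum>k\<in>{1..r}. of_int (a' (Suc r) k) *\<^sub>R b k) + of_int A *\<^sub>R w"
      using old [of r "\<lambda>k. of_int (a' (Suc r) k)"] by (simp add: a'_def b'_def)
    also have "(\<Sum>k\<in>{1..r}. of_int (a' (Suc r) k) *\<^sub>R b k) = (\<Sum>k\<in>{1..r}. of_int (m k mod A) *\<^sub>R b k)"
      by (intro sum.cong) (auto simp: a'_def)
    also have "\<dots> = (\<Sum>k\<in>{1..r}. (of_int (m k) - of_int A * of_int (m k div A)) *\<^sub>R b k)"
      by (simp only: minus_mult_div_eq_mod [symmetric] of_int_diff of_int_mult)
    also have "\<dots> + of_int A *\<^sub>R w = of_int A *\<^sub>R v + (\<Sum>k\<in>{1..r}. of_int (m k) *\<^sub>R b k)"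
      by (simp add: w_def scaleR_add_right scaleR_diff_left scaleR_sum_right sum_subtractf)
    also have "\<dots> = u (Suc r)"
      using m by (simp add: algebra_simps)
    finally show ?thesis by simp
  qed
  show ?case
  proof (intro exI [of _ b'] exI [of _ a'] conjI ballI allI impI)
    fix i assume i: "i \<in> {1..Suc r}"
    show "b' i \<in> \<Lambda>"
      using i w ba by (cases "i = Suc r") (auto simp: b'_def)
    show "u i = (\<Sum>k\<in>{1..i}. of_int (a' i k) *\<^sub>R b' k)"
    proof (cases "i = Suc r")
      case False
      then show ?thesis using i ba [of i] old [of i "\<lambda>k. of_int (a i k)"] by (simp add: a'_def)
    qed (use new in simp)
    show "1 \<le> a' i i"
      using i ba A_pos by (cases "i = Suc r") (auto simp: a'_def)
    fix k assume k: "k \<in> {1..<i}"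
    show "0 \<le> a' i k" "a' i k < a' i i"
      using i k ba [of i] A_pos by (cases "i = Suc r"; force simp: a'_def)+
  next
    fix c assume "(\<Sum>i\<in>{1..Suc r}. c i *\<^sub>R u i) \<in> \<Lambda>"
    then have c: "lc c \<in> \<Lambda>" by (simp add: lc_def)
    obtain s where s: "of_int N * c (Suc r) = of_int s * real p"
      using p_dvd [OF c] by blast
    have cs: "c (Suc r) = of_int s * cv (Suc r)"
    proof -
      have "of_int N * c (Suc r) = of_int N * (of_int s * cv (Suc r))"
        using s cv(2) by simp
      then show ?thesis using N by simp
    qed
    have "lc c - of_int s *\<^sub>R v = lc (\<lambda>i. c i - of_int s * cv i)"
      unfolding v_def by (rule lc_diff)
    moreover have "lc c - of_int s *\<^sub>R v \<in> \<Lambda>"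
      unfolding v_def by (intro d comb(2) cv(1) c)
    ultimately obtain n :: "nat \<Rightarrow> int"
      where n: "lc c - of_int s *\<^sub>R v = (\<Sum>i\<in>{1..r}. of_int (n i) *\<^sub>R b i)"
      using lc_gen [of "\<lambda>i. c i - of_int s * cv i"] cs by auto
    define n' where "n' = (\<lambda>i. if i = Suc r then s else n i - s * (m i div A))"
    have "(\<Sum>i\<in>{1..Suc r}. of_int (n' i) *\<^sub>R b' i) = (\<Sum>i\<in>{1..r}. of_int (n' i) *\<^sub>R b i) + of_int s *\<^sub>R w"
      using old [of r "\<lambda>k. of_int (n' k)"] by (simp add: n'_def b'_def)
    also have "(\<Sum>i\<in>{1..r}. of_int (n' i) *\<^sub>R b i) = (\<Sum>i\<in>{1..r}. of_int (n i - s * (m i div A)) *\<^sub>R b i)"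
      by (intro sum.cong) (auto simp: n'_def)
    also have "\<dots> + of_int s *\<^sub>R w = of_int s *\<^sub>R v + (\<Sum>i\<in>{1..r}. of_int (n i) *\<^sub>R b i)"
      by (simp add: w_def scaleR_add_right scaleR_diff_left scaleR_sum_right sum_subtractf)
    also have "\<dots> = lc c"
      using n by (simp add: algebra_simps)
    finally show "\<exists>m::nat \<Rightarrow> int. (\<Sum>i\<in>{1..Suc r}. c i *\<^sub>R u i) = (\<Sum>i\<in>{1..Suc r}. of_int (m i) *\<^sub>R b' i)"
      by (intro exI [of _ n']) (simp add: lc_def)
  qed
qed

section \<open>A basis in which all width vectors have small coordinates\<close>

lemma cross_polytope_in_width_ball:
  fixes A :: "real^'n^'n"
  assumes T: "finite T" "T \<noteq> {}" and A: "\<And>j. width T (column j A) \<le> 1"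
    and x: "(\<Sum>j\<in>UNIV. \<bar>x $ j\<bar>) \<le> 1"
  shows "A *v x \<in> width_ball T 1"
  unfolding width_ball_def width_le_iff [OF T] mem_Collect_eq
proof (intro ballI)
  fix s t assume st: "s \<in> T" "t \<in> T"
  have "\<bar>column j A \<bullet> (s - t)\<bar> \<le> 1" for j
    using width_ge [OF T(1) st, of "column j A"] width_ge [OF T(1) st(2,1), of "column j A"] A [of j]
    by (simp add: inner_diff_right)
  then have "x $ j * (column j A \<bullet> (s - t)) \<le> \<bar>x $ j\<bar>" for j
    using mult_left_mono [of "\<bar>column j A \<bullet> (s - t)\<bar>" 1 "\<bar>x $ j\<bar>"] by (simp add: abs_mult [symmetric])
  moreover have "(A *v x) \<bullet> (s - t) = (\<Sum>j\<in>UNIV. x $ j * (column j A \<bullet> (s - t)))"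
    by (simp add: matrix_mult_sum inner_sum_left scalar_mult_eq_scaleR)
  ultimately have "(A *v x) \<bullet> (s - t) \<le> (\<Sum>j\<in>UNIV. \<bar>x $ j\<bar>)"
    by (simp add: sum_mono)
  with x show "(A *v x) \<bullet> (s - t) \<le> 1"
    by linarith
qed

text \<open>
  Cramer's rule expresses a coordinate of \<open>w\<close> as a quotient of determinants whose numerator comes from
  replacing one column of \<open>A\<close> by \<open>w\<close>. The new matrix still has columns in \<open>W\<close>, so its determinant is not larger than that of \<open>A\<close>.
\<close>

lemma maximal_determinant_columns:
  fixes W :: "(real^'n) set"
  assumes fin: "finite W" and S: "S \<subseteq> W" "independent S" "card S = CARD('n)"
  obtains A :: "real^'n^'n" where "det A \<noteq> 0" "\<And>j. column j A \<in> W"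
    "\<And>w. w \<in> W \<Longrightarrow> \<exists>x. A *v x = w \<and> (\<forall>j. \<bar>x $ j\<bar> \<le> 1)"
proof -
  define F where "F = {A::real^'n^'n. \<forall>j. column j A \<in> W}"
  have "finite F"
  proof (rule finite_subset)
    show "F \<subseteq> (\<lambda>g. \<chi> i j. g j $ i) ` (UNIV \<rightarrow>\<^sub>E W)"
    proof
      fix A assume "A \<in> F"
      then show "A \<in> (\<lambda>g. \<chi> i j. g j $ i) ` (UNIV \<rightarrow>\<^sub>E W)"
        by (intro image_eqI [of _ _ "\<lambda>j. column j A"]) (auto simp: F_def column_def vec_eq_iff)
    qed
    show "finite ((\<lambda>g. \<chi> i j. g j $ i) ` (UNIV \<rightarrow>\<^sub>E W) :: (real^'n^'n) set)"
      using fin by (intro finite_imageI finite_PiE) auto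
  qed
  obtain g where g: "bij_betw g {1..CARD('n)} S"
    using finite_same_card_bij [of "{1..CARD('n)}" S] S fin by (auto dest: finite_subset)
  then have gdet: "det (basis_matrix g :: real^'n^'n) \<noteq> 0"
    using S by (simp add: independent_basis_matrix_iff [symmetric] bij_betw_def)
  have gF: "basis_matrix g \<in> F"
    using bij_betwE [OF g] S(1) enum_index_in [where 'n='n]
    by (auto simp: F_def basis_matrix_def column_def)
  obtain A where A: "A \<in> F" "\<And>A'. A' \<in> F \<Longrightarrow> \<bar>det A'\<bar> \<le> \<bar>det A\<bar>"
  proof -
    have "Max ((\<lambda>A. \<bar>det A\<bar>) ` F) \<in> (\<lambda>A. \<bar>det A\<bar>) ` F"
      using \<open>finite F\<close> gF by (intro Max_in) auto
    then obtain A where "A \<in> F" "Max ((\<lambda>A. \<bar>det A\<bar>) ` F) = \<bar>det A\<bar>"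
      by auto
    moreover have "\<bar>det A'\<bar> \<le> Max ((\<lambda>A. \<bar>det A\<bar>) ` F)" if "A' \<in> F" for A'
      using \<open>finite F\<close> that by (intro Max_ge) auto
    ultimately show thesis
      using that by metis
  qed
  have nz: "det A \<noteq> 0"
    using A(2) [OF gF] gdet by auto
  show thesis
  proof (rule that [OF nz])
    show "column j A \<in> W" for j
      using A(1) by (simp add: F_def)
    fix w assume w: "w \<in> W"
    define R where "R k = (\<chi> i j. if j = k then w $ i else A $ i $ j)" for k
    define x where "x = (\<chi> k. det (R k) / det A)"
    have "R k \<in> F" for k
    proof -
      have "column j (R k) = (if j = k then w else column j A)" for j
        by (auto simp: R_def column_def vec_eq_iff)
      then show ?thesis
        using w A(1) by (simp add: F_def)
    qed
    then have "\<bar>x $ j\<bar> \<le> 1" for j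
      using A(2) nz by (simp add: x_def abs_divide)
    moreover have "A *v x = w"
      unfolding cramer [OF nz] x_def R_def ..
    ultimately show "\<exists>x. A *v x = w \<and> (\<forall>j. \<bar>x $ j\<bar> \<le> 1)"
      by blast
  qed
qed

text \<open>
  By Cramer's rule for the integer matrix that expresses \<open>A\<close> in terms of \<open>B\<close>, its determinant is a
  common denominator for the coordinates with respect to \<open>A\<close>.
\<close>

lemma integer_coordinate_denominator:
  fixes A B :: "real^'n^'n"
  assumes A: "det A \<noteq> 0" and B: "det B \<noteq> 0" and sub: "\<And>j. column j A \<in> (*v) B ` int_vectors"
  obtains N :: int where "0 < N"
    "\<And>x j. A *v x \<in> (*v) B ` int_vectors \<Longrightarrow> of_int N * x $ j \<in> \<int>"
proof -
  obtain Z where Z: "\<And>i j. Z $ i $ j \<in> \<int>" "A = B ** Z"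
    using integer_factor [OF sub] by blast
  have nz: "det Z \<noteq> 0"
    using A by (simp add: Z(2) det_mul)
  obtain m :: int where m: "det Z = of_int m"
    using integer_matrix_det [OF Z(1)] by (auto elim: Ints_cases)
  show thesis
  proof (rule that [of "\<bar>m\<bar>"])
    show "0 < \<bar>m\<bar>" using nz m by simp
    fix x j assume "A *v x \<in> (*v) B ` int_vectors"
    then obtain z where z: "z \<in> int_vectors" "A *v x = B *v z" by auto
    have "inj ((*v) B)"
      using B by (simp add: invertible_det_nz [symmetric] invertible_left_inverse matrix_left_invertible_injective)
    moreover have "B *v (Z *v x) = B *v z"
      using z(2) by (simp add: Z(2) matrix_vector_mul_assoc)
    ultimately have "Z *v x = z"
      by (auto dest: injD)
    then have "x $ j = det (\<chi> i k. if k = j then z $ i else Z $ i $ k) / det Z"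
      using cramer [OF nz] by simp
    then have "of_int m * x $ j = det (\<chi> i k. if k = j then z $ i else Z $ i $ k)"
      using nz m by simp
    also have "\<dots> \<in> \<int>"
      using Z(1) z(1) by (intro integer_matrix_det) (auto simp: int_vectors_def)
    finally have "of_int m * x $ j \<in> \<int>" .
    then show "of_int \<bar>m\<bar> * x $ j \<in> \<int>"
      by (auto simp: abs_if)
  qed
qed

text \<open>
  Here \<open>k\<close> is the index in \<open>\<Lambda>\<close> of the lattice spanned by width vectors of maximal determinant, and \<open>b\<close> is
  the triangular basis for them. Dimension one is singled out because there the volume bound only gives \<open>k \<le> 2\<close>.
\<close>

lemma width_vectors_basis:
  fixes M L T :: "(real^'n) set"
  assumes triple: "(M, L, T) \<in> tiling_triples" and full: "aff_dim T = int CARD('n)"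
    and S: "S \<subseteq> width_vectors T L" "independent S" "card S = CARD('n)"
  obtains b :: "nat \<Rightarrow> real^'n" and k :: nat
  where "is_lattice_basis CARD('n) b (dual_lattice L)" "1 \<le> k"
    "k \<le> 2 ^ CARD('n) * fact CARD('n)" "CARD('n) = 1 \<Longrightarrow> k = 1"
    "width_vectors T L \<subseteq> (\<Sum>i\<in>{1..CARD('n)}. (\<lambda>m::int. of_int m *\<^sub>R b i) ` {- int k..int k})"
proof -
  let ?W = "width_vectors T L" and ?\<Lambda> = "dual_lattice L"
  have T: "finite T" "T \<noteq> {}" and L: "lattice_of_rank CARD('n) L"
    using triple by (auto simp: tiling_triples_def)
  obtain b0 where b0: "is_lattice_basis CARD('n) b0 ?\<Lambda>"
    using dual_lattice_basis [OF L] by blast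
  then have dual: "?\<Lambda> = (*v) (basis_matrix b0) ` int_vectors" and b0_nz: "det (basis_matrix b0) \<noteq> 0"
    by (auto simp: is_lattice_basis_iff)
  have sub: "0 \<in> ?\<Lambda>" "\<forall>x\<in>?\<Lambda>. \<forall>y\<in>?\<Lambda>. x - y \<in> ?\<Lambda>"
    by (auto simp: dual_lattice_def inner_diff_left)
  obtain A :: "real^'n^'n" where A: "det A \<noteq> 0" "\<And>j. column j A \<in> ?W"
    and A_coord: "\<And>w. w \<in> ?W \<Longrightarrow> \<exists>x. A *v x = w \<and> (\<forall>j. \<bar>x $ j\<bar> \<le> 1)"
    using maximal_determinant_columns [OF width_vectors_count(1) [OF triple full] S] by blast
  have A_dual: "column j A \<in> (*v) (basis_matrix b0) ` int_vectors" for j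
    using A(2) [of j] by (simp add: width_vectors_iff dual [symmetric])
  obtain N :: int where N: "0 < N"
    "\<And>x j. A *v x \<in> (*v) (basis_matrix b0) ` int_vectors \<Longrightarrow> of_int N * x $ j \<in> \<int>"
    using integer_coordinate_denominator [OF A(1) b0_nz A_dual] by blast
  obtain u where u: "basis_matrix u = A"
    by (rule basis_matrix_surj)
  have col: "column j A = u (enum_index j)" for j
    by (simp add: u [symmetric] basis_matrix_def column_def vec_eq_iff)
  have uW: "u i \<in> ?W" if i: "i \<in> {1..CARD('n)}" for i
  proof -
    obtain j :: 'n where "enum_index j = i"
      using i by (rule obtain_enum_index)
    then show ?thesis using A(2) [of j] by (simp add: col)
  qed
  have uL: "\<forall>i\<in>{1..CARD('n)}. u i \<in> ?\<Lambda>"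
    using uW by (simp add: width_vectors_iff)
  have "\<forall>i\<in>{1..CARD('n)}. of_int N * c i \<in> \<int>" if "(\<Sum>i\<in>{1..CARD('n)}. c i *\<^sub>R u i) \<in> ?\<Lambda>" for c
  proof
    fix i assume i: "i \<in> {1..CARD('n)}"
    obtain j :: 'n where "enum_index j = i"
      using i by (rule obtain_enum_index)
    then show "of_int N * c i \<in> \<int>"
      using N(2) [of "\<chi> j. c (enum_index j)" j] that unfolding basis_matrix_mult [symmetric] u dual by simp
  qed
  then have uint: "\<forall>c. (\<Sum>i\<in>{1..CARD('n)}. c i *\<^sub>R u i) \<in> ?\<Lambda> \<longrightarrow> (\<forall>i\<in>{1..CARD('n)}. of_int N * c i \<in> \<int>)"
    by blast
  from triangular_lattice_basis [OF sub N(1) uL uint]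
  obtain b and a :: "nat \<Rightarrow> nat \<Rightarrow> int" where
    ba: "\<forall>i\<in>{1..CARD('n)}. b i \<in> ?\<Lambda> \<and> u i = (\<Sum>k\<in>{1..i}. of_int (a i k) *\<^sub>R b k) \<and> 1 \<le> a i i \<and>
        (\<forall>k\<in>{1..<i}. 0 \<le> a i k \<and> a i k < a i i)"
    and gen: "\<forall>c. (\<Sum>i\<in>{1..CARD('n)}. c i *\<^sub>R u i) \<in> ?\<Lambda> \<longrightarrow>
        (\<exists>m::nat \<Rightarrow> int. (\<Sum>i\<in>{1..CARD('n)}. c i *\<^sub>R u i) = (\<Sum>i\<in>{1..CARD('n)}. of_int (m i) *\<^sub>R b i))"
    by (elim exE conjE) (rule that)
  define B where "B = basis_matrix b"
  \<comment> \<open>\<open>a i k\<close> is meaningful only for \<open>k \<le> i\<close>.\<close>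
  define r where "r i k = (if k \<le> i then a i k else 0)" for i k
  define R :: "real^'n^'n" where "R = (\<chi> k i. of_int (r (enum_index i) (enum_index k)))"
  define P where "P = (\<Prod>i\<in>{1..CARD('n)}. a i i)"
  have u_eq: "u i = (\<Sum>k\<in>{1..CARD('n)}. of_int (r i k) *\<^sub>R b k)" if i: "i \<in> {1..CARD('n)}" for i
  proof -
    have "u i = (\<Sum>k\<in>{1..i}. of_int (a i k) *\<^sub>R b k)"
      using ba i by blast
    also have "\<dots> = (\<Sum>k\<in>{1..CARD('n)}. of_int (r i k) *\<^sub>R b k)"
      using i by (intro sum.mono_neutral_cong_left) (auto simp: r_def)
    finally show ?thesis .
  qed
  have "column j A = column j (B ** R)" for j
  proof -
    have "column j A = B *v (\<chi> k. of_int (r (enum_index j) (enum_index k)))"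
      unfolding col u_eq [OF enum_index_in] B_def basis_matrix_mult [of b "\<lambda>k. of_int (r (enum_index j) k)"] ..
    then show ?thesis
      by (simp add: R_def column_def vec_eq_iff matrix_matrix_mult_def matrix_vector_mult_def)
  qed
  then have ABR: "A = B ** R"
    by (simp add: column_def vec_eq_iff)
  have "det R = (\<Prod>i\<in>UNIV. R $ i $ i)"
  proof (rule det_triangular [OF inj_enum_index])
    fix i j :: 'n assume "enum_index j < enum_index i"
    then show "R $ i $ j = 0" by (simp add: R_def r_def)
  qed
  also have "\<dots> = of_int P"
    unfolding P_def R_def r_def of_int_prod
    using prod_enum_index [where 'n='n, of "\<lambda>i. of_int (a i i) :: real"] by simp
  finally have detA: "det A = det B * of_int P"
    by (simp add: ABR det_mul)
  then have B_nz: "det B \<noteq> 0"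
    using A(1) by auto
  have P1: "1 \<le> P"
    unfolding P_def using ba by (intro prod_ge_1) blast
  have "?\<Lambda> = (*v) B ` int_vectors"
  proof
    show "?\<Lambda> \<subseteq> (*v) B ` int_vectors"
    proof
      fix y assume y: "y \<in> ?\<Lambda>"
      obtain x where "A *v x = y"
        using cramer [OF A(1)] by blast
      moreover obtain c where "x = (\<chi> j. c (enum_index j))"
        by (rule vec_as_enum)
      ultimately have yc: "y = (\<Sum>i\<in>{1..CARD('n)}. c i *\<^sub>R u i)"
        by (simp add: u [symmetric] basis_matrix_mult)
      have "(\<Sum>i\<in>{1..CARD('n)}. c i *\<^sub>R u i) \<in> ?\<Lambda>"
        using y by (simp only: yc)
      from mp [OF spec [OF gen] this] obtain m :: "nat \<Rightarrow> int"
        where "y = (\<Sum>i\<in>{1..CARD('n)}. of_int (m i) *\<^sub>R b i)"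
        unfolding yc ..
      then have "y = B *v (\<chi> j. of_int (m (enum_index j)))"
        unfolding B_def basis_matrix_mult [of b "\<lambda>i. of_int (m i)"] .
      then show "y \<in> (*v) B ` int_vectors"
        by (rule image_eqI) (simp add: int_vectors_def)
    qed
    show "(*v) B ` int_vectors \<subseteq> ?\<Lambda>"
    proof
      fix y assume "y \<in> (*v) B ` int_vectors"
      then obtain z where z: "z \<in> int_vectors" "y = B *v z" by blast
      obtain c where c: "z = (\<chi> j. c (enum_index j))"
        by (rule vec_as_enum)
      have y: "y = (\<Sum>i\<in>{1..CARD('n)}. c i *\<^sub>R b i)"
        by (simp add: z(2) c B_def basis_matrix_mult)
      show "y \<in> ?\<Lambda>"
        unfolding y
      proof (rule subgroup_int_combination(3) [OF sub])
        fix i assume i: "i \<in> {1..CARD('n)}"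
        obtain j :: 'n where "enum_index j = i"
          using i by (rule obtain_enum_index)
        then have "c i \<in> \<int>"
          using z(1) by (auto simp: int_vectors_def c)
        then obtain m :: int where "c i = of_int m"
          by (auto elim: Ints_cases)
        then show "c i *\<^sub>R b i \<in> ?\<Lambda>"
          using subgroup_int_combination(2) [OF sub, of "b i" m] ba i by simp
      qed
    qed
  qed
  with B_nz have basis: "is_lattice_basis CARD('n) b ?\<Lambda>"
    by (simp add: is_lattice_basis_iff B_def)
  have P_bound: "real_of_int P \<le> 2 ^ CARD('n) * fact CARD('n)"
  proof -
    let ?X = "{x::real^'n. (\<Sum>i\<in>UNIV. \<bar>x $ i\<bar>) \<le> 1}"
    have "(*v) A ` ?X \<subseteq> width_ball T 1"
      using A(2) by (auto intro!: cross_polytope_in_width_ball [OF T] simp: width_vectors_iff less_imp_le)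
    then have "vol ((*v) A ` ?X) \<le> vol (width_ball T 1)"
      using measure_matrix_image [OF measure_cross_polytope(1), of A] width_ball_lmeasurable [OF T full]
      by (intro measure_mono_fmeasurable fmeasurableD) auto
    also have "\<dots> \<le> 4 ^ CARD('n) * \<bar>det B\<bar>"
      using polar_volume_bound [OF triple full]
      by (simp add: polar_difference_set [OF T] lattice_det_basis [OF basis] B_def)
    finally have "\<bar>det A\<bar> * (2 ^ CARD('n) / fact CARD('n)) \<le> 4 ^ CARD('n) * \<bar>det B\<bar>"
      using measure_matrix_image [OF measure_cross_polytope(1), of A]
      by (simp only: measure_cross_polytope(2))
    then have "\<bar>det B\<bar> * (of_int P * 2 ^ CARD('n) / fact CARD('n)) \<le> \<bar>det B\<bar> * 4 ^ CARD('n)"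
      using P1 by (simp add: detA abs_mult mult_ac)
    then have "of_int P * 2 ^ CARD('n) / fact CARD('n) \<le> (4::real) ^ CARD('n)"
      by (rule mult_left_le_imp_le) (use B_nz in simp)
    then have "of_int P * 2 ^ CARD('n) \<le> (2 ^ CARD('n) * fact CARD('n)) * (2::real) ^ CARD('n)"
      by (simp add: field_simps power_mult_distrib [symmetric])
    then show ?thesis
      by (simp add: mult.commute)
  qed
  have P_one: "P = 1" if n1: "CARD('n) = 1"
  proof -
    have 1: "1 \<in> {1..CARD('n)}" by simp
    have "b 1 \<in> ?\<Lambda>" using ba 1 by blast
    moreover have u1: "u 1 = of_int P *\<^sub>R b 1"
      using ba n1 by (simp add: P_def)
    moreover have "b 1 \<noteq> 0"
      using u1 uW [OF 1] by (auto simp: width_vectors_iff)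
    ultimately have "1 / 2 \<le> width T (b 1)"
      using dual_vector_width_ge_half [OF triple full] by blast
    moreover have "of_int P * width T (b 1) < 1"
      using uW [OF 1] P1 unfolding u1 width_vectors_iff by (simp add: width_scaleR [OF T])
    ultimately have "real_of_int P < 2"
      using P1 mult_left_mono [of "1 / 2" "width T (b 1)" "of_int P"] by linarith
    then show ?thesis using P1 by linarith
  qed
  have coord: "\<exists>x. w = B *v x \<and> (\<forall>k. x $ k \<in> of_int ` {- P..P})" if w: "w \<in> ?W" for w
  proof -
    obtain x where x: "A *v x = w" "\<And>j. \<bar>x $ j\<bar> \<le> 1"
      using A_coord [OF w] by blast
    have wR: "w = B *v (R *v x)"
      using x(1) by (simp add: ABR matrix_vector_mul_assoc)
    have "w \<in> (*v) B ` int_vectors"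
      using w \<open>?\<Lambda> = (*v) B ` int_vectors\<close> by (simp add: width_vectors_iff)
    then obtain z where z: "z \<in> int_vectors" "w = B *v z" by blast
    have "inj ((*v) B)"
      using B_nz by (simp add: invertible_det_nz [symmetric] invertible_left_inverse matrix_left_invertible_injective)
    then have zR: "z = R *v x"
      using z(2) wR by (auto dest: injD)
    have "z $ k \<in> of_int ` {- P..P}" for k
    proof -
      obtain m :: int where m: "z $ k = of_int m"
        using z(1) by (auto simp: int_vectors_def elim: Ints_cases)
      let ?k = "enum_index k"
      have "\<bar>z $ k\<bar> \<le> (\<Sum>i\<in>UNIV. \<bar>R $ k $ i * x $ i\<bar>)"
        unfolding zR by (simp add: matrix_vector_mult_def sum_abs)
      also have "\<dots> \<le> (\<Sum>i\<in>UNIV. of_int (r (enum_index (i::'n)) ?k))"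
      proof (intro sum_mono)
        fix i :: 'n
        have "0 \<le> r (enum_index i) ?k"
          using bspec [OF ba enum_index_in [of i]] enum_index_in [of k] by (cases "?k = enum_index i") (auto simp: r_def)
        then show "\<bar>R $ k $ i * x $ i\<bar> \<le> of_int (r (enum_index i) ?k)"
          using mult_left_mono [OF x(2) [of i], of "of_int (r (enum_index i) ?k)"]
          by (simp add: R_def abs_mult)
      qed
      also have "\<dots> = of_int (\<Sum>i\<in>{1..CARD('n)}. r i ?k)"
        using sum_enum_index [where 'n='n, of "\<lambda>i. of_int (r i ?k) :: real"] by simp
      \<comment> \<open>Off the diagonal an entry of row \<open>i\<close> is a remainder modulo \<open>a i i\<close>, hence at most \<open>a i i - 1\<close>.\<close>
      also have "(\<Sum>i\<in>{1..CARD('n)}. r i ?k) \<le> (\<Sum>i\<in>{1..CARD('n)}. (if i = ?k then 1 else 0) + (a i i - 1))"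
      proof (intro sum_mono)
        fix i assume i: "i \<in> {1..CARD('n)}"
        show "r i ?k \<le> (if i = ?k then 1 else 0) + (a i i - 1)"
          using bspec [OF ba i] enum_index_in [of k] by (cases "?k = i") (auto simp: r_def)
      qed
      also have "\<dots> = 1 + (\<Sum>i\<in>{1..CARD('n)}. a i i - 1)"
        using enum_index_in [of k] by (simp add: sum.distrib)
      also have "\<dots> \<le> P"
        unfolding P_def using ba by (intro one_plus_sum_le_prod) auto
      finally have "\<bar>m\<bar> \<le> P"
        unfolding m by linarith
      then show ?thesis
        unfolding m by (intro imageI) auto
    qed
    then show ?thesis using z(2) by blast
  qed
  show thesis
  proof (rule that [OF basis, of "nat P"])
    show "1 \<le> nat P" using P1 by simp
    have "real (nat P) \<le> real (2 ^ CARD('n) * fact CARD('n))"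
      using P1 P_bound by simp
    then show "nat P \<le> 2 ^ CARD('n) * fact CARD('n)"
      by (simp only: of_nat_le_iff)
    show "nat P = 1" if "CARD('n) = 1"
      using P_one [OF that] by simp
    show "?W \<subseteq> (\<Sum>i\<in>{1..CARD('n)}. (\<lambda>m::int. of_int m *\<^sub>R b i) ` {- int (nat P)..int (nat P)})"
      unfolding set_sum_image_eq B_def [symmetric] using coord P1 by fastforce
  qed
qed

text \<open>
  Passing from \<open>d\<close> to \<open>d + 1\<close> multiplies \<open>2^d\<close> by 2, but \<open>2 (3/2)^(d-2) d!\<close> by \<open>3/2 (d + 1)\<close>, which is more;
  equality holds at \<open>d = 2\<close>.
\<close>

lemma box_size_bound:
  assumes n: "1 \<le> n" and k: "k \<le> 2 ^ n * fact n" "n = 1 \<Longrightarrow> k = 1"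
  shows "real k \<le> 2 * (3 / 2) powi (int n - 2) * (fact n)\<^sup>2"
proof (cases "n = 1")
  case True
  then show ?thesis
    using k(2) by (simp add: power_int_minus)
next
  case False
  have pow: "(2::real) ^ (m + 2) \<le> 2 * (3 / 2) ^ m * fact (m + 2)" for m
  proof (induction m)
    case (Suc m)
    have "(2::real) * 2 ^ (m + 2) \<le> (3 / 2 * (real m + 3)) * (2 * (3 / 2) ^ m * fact (m + 2))"
      using Suc.IH by (intro mult_mono) auto
    also have "\<dots> = 2 * (3 / 2) ^ Suc m * ((real m + 3) * fact (m + 2))"
      by simp
    also have "(real m + 3) * fact (m + 2) = fact (Suc m + 2)"
      by (simp add: fact_Suc [of "m + 2"] algebra_simps)
    finally show ?case by simp
  qed (simp add: fact_numeral)
  obtain m where m: "n = m + 2"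
    using False n by (metis add.commute le_Suc_ex nat_less_le Suc_1 Suc_leI One_nat_def)
  have "real k \<le> real (2 ^ n * fact n)"
    using k(1) by (simp only: of_nat_le_iff)
  also have "\<dots> = 2 ^ n * fact n"
    by simp
  also have "\<dots> \<le> (2 * (3 / 2) ^ m * fact n) * fact n"
    unfolding m by (intro mult_right_mono pow) simp
  also have "\<dots> = 2 * (3 / 2) powi (int n - 2) * (fact n)\<^sup>2"
    by (simp add: m power2_eq_square)
  finally show ?thesis .
qed

theorem theorem2p3:
  fixes M L T :: "(real ^ 'n) set"
  assumes "(M, L, T) \<in> tiling_triples"
    and "aff_dim T = int CARD('n)"
    and "\<exists>S. S \<subseteq> width_vectors T L \<and> independent S \<and> card S = CARD('n)"
  shows
    "(\<exists>(b :: nat \<Rightarrow> real ^ 'n) (k :: nat).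
        is_lattice_basis CARD('n) b (dual_lattice L) \<and>
        1 \<le> k \<and>
        real k \<le> 2 * (3 / 2) powi (int CARD('n) - 2) * (fact CARD('n))\<^sup>2 \<and>
        width_vectors T L \<subseteq>
          (\<Sum>i\<in>{1..CARD('n)}. (\<lambda>m::int. of_int m *\<^sub>R b i) ` {- int k..int k})) \<and>
     (finite (width_vectors T L) \<and> card (width_vectors T L) < 4 ^ CARD('n)) \<and>
     (vol (convex hull (width_vectors T L)) < vol (polar (difference_set T)) \<and>
      vol (polar (difference_set T)) \<le> 4 ^ CARD('n) * lattice_det (dual_lattice L) \<and>
      4 ^ CARD('n) * lattice_det (dual_lattice L) = 4 ^ CARD('n) / lattice_det L)"
proof -
  have T: "finite T" "T \<noteq> {}" and L: "lattice_of_rank CARD('n) L"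
    using assms(1) by (auto simp: tiling_triples_def)
  obtain S where S: "S \<subseteq> width_vectors T L" "independent S" "card S = CARD('n)"
    using assms(3) by blast
  obtain b k where "is_lattice_basis CARD('n) b (dual_lattice L)" "1 \<le> k"
    and "k \<le> 2 ^ CARD('n) * fact CARD('n)" "CARD('n) = 1 \<Longrightarrow> k = 1"
    and "width_vectors T L \<subseteq> (\<Sum>i\<in>{1..CARD('n)}. (\<lambda>m::int. of_int m *\<^sub>R b i) ` {- int k..int k})"
    using width_vectors_basis [OF assms(1,2) S] by blast
  moreover from this have "real k \<le> 2 * (3 / 2) powi (int CARD('n) - 2) * (fact CARD('n))\<^sup>2"
    by (intro box_size_bound) (simp_all add: Suc_le_eq)
  moreover have "lattice_det (dual_lattice L) = 1 / lattice_det L"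
    using dual_lattice_basis [OF L] by blast
  ultimately show ?thesis
    using width_vectors_count [OF assms(1,2)] polar_volume_bound [OF assms(1,2)]
      width_vectors_hull_volume [OF T assms(2) width_vectors_count(1) [OF assms(1,2)]]
    by auto
qed

end
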